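(* Let $k$ be a field, $n\ge1$, $K=k((t_n))\dots((t_1))$ with its standard $C_n$-structure, $\bar K=k((t_n))\dots((t_2))$ with its standard $C_{n-1}$-structure (so $K=\bar K((t_1))$), $\mathrm{End}_K=\mathrm{Mor}_{C_n}(K,K)$ and $\mathrm{End}_{\bar K}=\mathrm{Mor}_{C_{n-1}}(\bar K,\bar K)$. For a $k$-linear endomorphism $A\in\mathrm{End}_k(K)$ consider the matrix $(A_{ij})_{i,j\in\mathbb Z}$, $A_{ij}\in\mathrm{End}_k(\bar K)$, given by $A(x t_1^i)=\sum_j A_{ij}(x)t_1^j$ for $x\in\bar K$. Then $A\in\mathrm{End}_k(K)$ belongs to $\mathrm{End}_K$ if and only if the following conditions are satisfied: 1. There is a nondecreasing function $a:\mathbb Z\to\mathbb Z$, with $a(i)\to\infty$ when $i\to\infty$, such that for $j<a(i)$ all elements $A_{ij}=0$. 2. Any element $A_{ij}$ belongs to $\mathrm{End}_{\bar K}$.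
   Context: All vector spaces are over a fixed field $k$. **Filtered spaces.** A filtered $k$-vector space is a triple $(I,F,V)$ where $V$ is a $k$-vector space, $I$ is a partially ordered set such that for any $i,j\in I$ there are $p,l\in I$ with $p\le i\le l$ and $p\le j\le l$, and $F$ is a function from $I$ to the set of $k$-subspaces of $V$ such that $i\le j$ implies $F(i)\subset F(j)$, $\bigcap_{i\in I}F(i)=0$ and $\bigcup_{i\in I}F(i)=V$. A filtered space $(I_1,F_1,V)$ dominates a filtered space $(I_2,F_2,V)$ when there is an order-preserving function $\phi:I_2\to I_1$ such that $F_1(\phi(i))=F_2(i)$ for all $i\in I_2$, and for every $j\in I_1$ there are $i_1,i_2\in I_2$ with $\phi(i_1)\le j\le\phi(i_2)$. **Category $C_n$** (defined by induction on $n$). Objects of $C_0$ are finite-dimensional $k$-vector spaces, with $k$-linear maps as morphisms; an admissible triple in $C_0$ is a short exact sequence. For $n\ge1$, an object of $C_n$ is a filtered $k$-vector space $E=(I,F,V)$ together with, for any $i\le j$ in $I$, a structure $E_{i,j}$ of object of $C_{n-1}$ on $F(j)/F(i)$, such that for any $i\le j\le l$ the natural triple $0\to E_{i,j}\to E_{i,l}\to E_{j,l}\to0$ is admissible in $C_{n-1}$. For objects $E_s=(I_s,F_s,V_s)$, $s=1,2,3$, of $C_n$, a triple $0\to E_1\to E_2\to E_3\to0$ is admissible when: (a) $0\to V_1\to V_2\to V_3\to0$ is exact; (b) $(I_1,F_1,V_1)$ dominates $(I_2,F_1',V_1)$, $F_1'(i)=F_2(i)\cap V_1$; (c) $(I_3,F_3,V_3)$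 dominates $(I_2,F_3',V_3)$, $F_3'(i)=F_2(i)/(F_2(i)\cap V_1)$; (d) for any $i\le j$ in $I_2$ the triple $0\to F_1'(j)/F_1'(i)\to F_2(j)/F_2(i)\to F_3'(j)/F_3'(i)\to0$ is admissible in $C_{n-1}$ (the three terms carry the $C_{n-1}$-structures given by $E_1$, $E_2$, $E_3$ respectively). $\mathrm{Mor}_{C_n}(E_1,E_2)$ consists of all $A\in\mathrm{Hom}_k(V_1,V_2)$ such that: (1) for any $i\in I_1$ there is $j\in I_2$ with $A(F_1(i))\subset F_2(j)$; (2) for any $j\in I_2$ there is $i\in I_1$ with $A(F_1(i))\subset F_2(j)$; (3) for any $i_1\le i_2$ in $I_1$ and $j_1\le j_2$ in $I_2$ with $A(F_1(i_1))\subset F_2(j_1)$ and $A(F_1(i_2))\subset F_2(j_2)$, the induced map $F_1(i_2)/F_1(i_1)\to F_2(j_2)/F_2(j_1)$ is in $\mathrm{Mor}_{C_{n-1}}$. **Standard $C_n$-structure on $K=k((t_n))\dots((t_1))$.** Filter $K$ by $E_l=t_1^l\,k((t_n))\dots((t_2))[[t_1]]$, $l\in\mathbb Z$ (larger $l$ gives smaller subspace). On each quotient $E_{l_1}/E_{l_1'}$ ($l_1\le l_1'$) take the filtration by images of $t_2^{m}t_1^{l_1}k((t_n))\dots((t_3))[[t_2,t_1]]$, $m\in\mathbb Z$, and so on: on a subquotient obtained after $r-1$ steps with numerator indices $l_1,\dots,l_{r-1}$ take the filtration by images of $t_r^{m}t_{r-1}^{l_{r-1}}\cdots t_1^{l_1}k((t_n))\dots((t_{r+1}))[[t_r,\dots,t_1]]$,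 $m\in\mathbb Z$; after $n$ steps the quotients are finite-dimensional. The same definition with variables $t_n,\dots,t_2$ gives the $C_{n-1}$-structure on $\bar K$ (for $n=1$, $\bar K=k\in C_0$).
   Formalization: The "if" part fails as written (a nonzero linear A can have zero matrix), so the right-hand side also requires that A acts by its matrix: A(∑ x_i t_1^i)=∑_j(∑_i A_ij(x_i))t_1^j with finite inner sums; every A in End_K is shown to satisfy this. *)

theory Defs
  imports Complex_Main "HOL-Library.Function_Algebras"
begin

section \<open>Subquotients\<close>

text \<open>
  A vector space is presented as a subquotient \<open>U / W\<close> of an ambient vector space, given by its
  scalar multiplication \<open>s\<close> on a type; a plain space \<open>U\<close> is \<open>U / 0\<close>. Subspaces of \<open>U / W\<close> are given
  by their preimages, that is by subspaces \<open>P\<close> with \<open>W \<subseteq> P \<subseteq> U\<close>, and \<open>(P / W) / (Q / W)\<close> is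
  identified with \<open>P / Q\<close>. A linear map \<open>U\<^sub>1 / W\<^sub>1 \<rightarrow> U\<^sub>2 / W\<^sub>2\<close> is given by any function that induces
  it on representatives. Thus iterated quotients stay in one type, and a map and the maps it induces
  on subquotients are given by the same function.
\<close>

definition subquotient ::
    "('k::field \<Rightarrow> 'v::ab_group_add \<Rightarrow> 'v) \<Rightarrow> 'v set \<Rightarrow> 'v set \<Rightarrow> bool" where
  "subquotient s U W \<longleftrightarrow> vector_space s \<and> module.subspace s U \<and> module.subspace s W \<and> W \<subseteq> U"

definition finite_dim_quotient ::
    "('k::field \<Rightarrow> 'v::ab_group_add \<Rightarrow> 'v) \<Rightarrow> 'v set \<Rightarrow> 'v set \<Rightarrow> bool" where
  "finite_dim_quotient s U W \<longleftrightarrow> (\<exists>B. finite B \<and> B \<subseteq> U \<and> U \<subseteq> module.span s (B \<union> W))"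

definition set_sum :: "'v::ab_group_add set \<Rightarrow> 'v set \<Rightarrow> 'v set" where
  "set_sum P Q = {x + y | x y. x \<in> P \<and> y \<in> Q}"

definition hom_quotient ::
    "('k::field \<Rightarrow> 'u::ab_group_add \<Rightarrow> 'u) \<Rightarrow> ('k \<Rightarrow> 'v::ab_group_add \<Rightarrow> 'v) \<Rightarrow>
     'u set \<Rightarrow> 'u set \<Rightarrow> 'v set \<Rightarrow> 'v set \<Rightarrow> ('u \<Rightarrow> 'v) set" where
  "hom_quotient s1 s2 U1 W1 U2 W2 =
     {f. f ` U1 \<subseteq> U2 \<and> f ` W1 \<subseteq> W2 \<and>
         (\<forall>x\<in>U1. \<forall>y\<in>U1. f (x + y) - (f x + f y) \<in> W2) \<and>
         (\<forall>c. \<forall>x\<in>U1. f (s1 c x) - s2 c (f x) \<in> W2)}"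

definition short_exact ::
    "('k::field \<Rightarrow> 'u::ab_group_add \<Rightarrow> 'u) \<Rightarrow> ('k \<Rightarrow> 'v::ab_group_add \<Rightarrow> 'v) \<Rightarrow>
     ('k \<Rightarrow> 'w::ab_group_add \<Rightarrow> 'w) \<Rightarrow> 'u set \<Rightarrow> 'u set \<Rightarrow> ('u \<Rightarrow> 'v) \<Rightarrow> 'v set \<Rightarrow> 'v set \<Rightarrow>
     ('v \<Rightarrow> 'w) \<Rightarrow> 'w set \<Rightarrow> 'w set \<Rightarrow> bool" where
  "short_exact s1 s2 s3 U1 W1 f U2 W2 g U3 W3 \<longleftrightarrow>
     f \<in> hom_quotient s1 s2 U1 W1 U2 W2 \<and> g \<in> hom_quotient s2 s3 U2 W2 U3 W3 \<and>
     {x \<in> U1. f x \<in> W2} = W1 \<and>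
     set_sum (f ` U1) W2 = {y \<in> U2. g y \<in> W3} \<and>
     set_sum (g ` U2) W3 = U3"

section \<open>Filtered spaces\<close>

definition filtered_space ::
    "('k::field \<Rightarrow> 'v::ab_group_add \<Rightarrow> 'v) \<Rightarrow> 'v set \<Rightarrow> 'v set \<Rightarrow> 'i set \<Rightarrow> 'i rel \<Rightarrow>
     ('i \<Rightarrow> 'v set) \<Rightarrow> bool" where
  "filtered_space s U W I r F \<longleftrightarrow>
     subquotient s U W \<and> partial_order_on I r \<and>
     (\<forall>i\<in>I. \<forall>j\<in>I. \<exists>p\<in>I. \<exists>l\<in>I. (p, i) \<in> r \<and> (i, l) \<in> r \<and> (p, j) \<in> r \<and> (j, l) \<in> r) \<and>
     (\<forall>i\<in>I. module.subspace s (F i) \<and> W \<subseteq> F i \<and> F i \<subseteq> U) \<and>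
     (\<forall>i j. (i, j) \<in> r \<longrightarrow> F i \<subseteq> F j) \<and>
     (\<Inter>i\<in>I. F i) = W \<and> (\<Union>i\<in>I. F i) = U"

text \<open>\<open>(I1, F1)\<close> dominates \<open>(I2, F2)\<close> by means of \<open>\<phi>\<close>.\<close>

definition dominates_via ::
    "('i2 \<Rightarrow> 'i1) \<Rightarrow> 'i1 set \<Rightarrow> 'i1 rel \<Rightarrow> ('i1 \<Rightarrow> 'v set) \<Rightarrow>
     'i2 set \<Rightarrow> 'i2 rel \<Rightarrow> ('i2 \<Rightarrow> 'v set) \<Rightarrow> bool" where
  "dominates_via \<phi> I1 r1 F1 I2 r2 F2 \<longleftrightarrow>
     \<phi> ` I2 \<subseteq> I1 \<and> (\<forall>i j. (i, j) \<in> r2 \<longrightarrow> (\<phi> i, \<phi> j) \<in> r1) \<and>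
     (\<forall>i\<in>I2. F1 (\<phi> i) = F2 i) \<and>
     (\<forall>j\<in>I1. \<exists>i1\<in>I2. \<exists>i2\<in>I2. (\<phi> i1, j) \<in> r1 \<and> (j, \<phi> i2) \<in> r1)"

section \<open>The categories \<open>C\<^sub>n\<close>\<close>

text \<open>
  Raw data of an object: its space \<open>upper / lower\<close> and, for positive level, the index poset, the
  filtration, and for \<open>i \<le> j\<close> the structure of lower level on \<open>filt j / filt i\<close>.
\<close>

datatype ('i, 'v) cn_data =
    is_Vect: Vect (upper: "'v set") (lower: "'v set")
  | is_Filtered: Filtered (upper: "'v set") (lower: "'v set") (index: "'i set") (index_le: "'i rel")
      (filt: "'i \<Rightarrow> 'v set") (quot: "'i \<Rightarrow> 'i \<Rightarrow> ('i, 'v) cn_data")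

text \<open>
  Admissible triples \<open>0 \<rightarrow> E1 \<rightarrow> E2 \<rightarrow> E3 \<rightarrow> 0\<close> with maps \<open>f\<close> and \<open>g\<close>. The structures on the outer
  terms of the triple of subquotients are those that \<open>E1\<close> and \<open>E3\<close> have at the indices chosen by the
  dominations.
\<close>

primrec cn_admissible ::
    "('k::field \<Rightarrow> 'u::ab_group_add \<Rightarrow> 'u) \<Rightarrow> ('k \<Rightarrow> 'v::ab_group_add \<Rightarrow> 'v) \<Rightarrow>
     ('k \<Rightarrow> 'w::ab_group_add \<Rightarrow> 'w) \<Rightarrow> nat \<Rightarrow> ('i1, 'u) cn_data \<Rightarrow> ('u \<Rightarrow> 'v) \<Rightarrow>
     ('i2, 'v) cn_data \<Rightarrow> ('v \<Rightarrow> 'w) \<Rightarrow> ('i3, 'w) cn_data \<Rightarrow> bool" where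
  "cn_admissible s1 s2 s3 0 E1 f E2 g E3 \<longleftrightarrow>
     short_exact s1 s2 s3 (upper E1) (lower E1) f (upper E2) (lower E2) g (upper E3) (lower E3)"
| "cn_admissible s1 s2 s3 (Suc n) E1 f E2 g E3 \<longleftrightarrow>
     short_exact s1 s2 s3 (upper E1) (lower E1) f (upper E2) (lower E2) g (upper E3) (lower E3) \<and>
     (\<exists>\<phi> \<psi>.
        dominates_via \<phi> (index E1) (index_le E1) (filt E1)
          (index E2) (index_le E2) (\<lambda>i. {x \<in> upper E1. f x \<in> filt E2 i}) \<and>
        dominates_via \<psi> (index E3) (index_le E3) (filt E3)
          (index E2) (index_le E2) (\<lambda>i. set_sum (g ` filt E2 i) (lower E3)) \<and>
        (\<forall>i j. (i, j) \<in> index_le E2 \<longrightarrow>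
           cn_admissible s1 s2 s3 n
             (quot E1 (\<phi> i) (\<phi> j)) f (quot E2 i j) g (quot E3 (\<psi> i) (\<psi> j))))"

primrec cn_object ::
    "('k::field \<Rightarrow> 'v::ab_group_add \<Rightarrow> 'v) \<Rightarrow> nat \<Rightarrow> ('i, 'v) cn_data \<Rightarrow> bool" where
  "cn_object s 0 E \<longleftrightarrow>
     is_Vect E \<and> subquotient s (upper E) (lower E) \<and> finite_dim_quotient s (upper E) (lower E)"
| "cn_object s (Suc n) E \<longleftrightarrow>
     is_Filtered E \<and> filtered_space s (upper E) (lower E) (index E) (index_le E) (filt E) \<and>
     (\<forall>i j. (i, j) \<in> index_le E \<longrightarrow>
        cn_object s n (quot E i j) \<and>
        upper (quot E i j) = filt E j \<and> lower (quot E i j) = filt E i) \<and>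
     (\<forall>i j l. (i, j) \<in> index_le E \<and> (j, l) \<in> index_le E \<longrightarrow>
        cn_admissible s s s n (quot E i j) (\<lambda>x. x) (quot E i l) (\<lambda>x. x) (quot E j l))"

primrec cn_mor ::
    "('k::field \<Rightarrow> 'u::ab_group_add \<Rightarrow> 'u) \<Rightarrow> ('k \<Rightarrow> 'v::ab_group_add \<Rightarrow> 'v) \<Rightarrow> nat \<Rightarrow>
     ('i1, 'u) cn_data \<Rightarrow> ('i2, 'v) cn_data \<Rightarrow> ('u \<Rightarrow> 'v) set" where
  "cn_mor s1 s2 0 E1 E2 = hom_quotient s1 s2 (upper E1) (lower E1) (upper E2) (lower E2)"
| "cn_mor s1 s2 (Suc n) E1 E2 =
     {A \<in> hom_quotient s1 s2 (upper E1) (lower E1) (upper E2) (lower E2).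
        (\<forall>i\<in>index E1. \<exists>j\<in>index E2. A ` filt E1 i \<subseteq> filt E2 j) \<and>
        (\<forall>j\<in>index E2. \<exists>i\<in>index E1. A ` filt E1 i \<subseteq> filt E2 j) \<and>
        (\<forall>i1 i2 j1 j2. (i1, i2) \<in> index_le E1 \<and> (j1, j2) \<in> index_le E2 \<and>
           A ` filt E1 i1 \<subseteq> filt E2 j1 \<and> A ` filt E1 i2 \<subseteq> filt E2 j2 \<longrightarrow>
           A \<in> cn_mor s1 s2 n (quot E1 i1 i2) (quot E2 j1 j2))}"

section \<open>Iterated Laurent series\<close>

text \<open>
  An element of \<open>k((t\<^sub>n))\<dots>((t\<^sub>1))\<close> is given by its coefficients: the list \<open>[m\<^sub>1, \<dots>, m\<^sub>n]\<close> is the exponent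
  of \<open>t\<^sub>n\<^bsup>m\<^sub>n\<^esup> \<dots> t\<^sub>1\<^bsup>m\<^sub>1\<^esup>\<close>. As \<open>t\<^sub>1\<close> comes first, \<open>coeff1 f i\<close> is the coefficient of \<open>t\<^sub>1\<^bsup>i\<^esup>\<close>, which lies in
  \<open>k((t\<^sub>n))\<dots>((t\<^sub>2))\<close>; the latter consists of coefficient functions on lists of length \<open>n - 1\<close>.
\<close>

type_synonym 'k iter_series = "int list \<Rightarrow> 'k"

definition coeff1 :: "'k iter_series \<Rightarrow> int \<Rightarrow> 'k iter_series" where
  "coeff1 f i = (\<lambda>m. f (i # m))"

text \<open>\<open>x t\<^sub>1\<^bsup>i\<^esup>\<close>\<close>

definition times_t1_power :: "'k::zero iter_series \<Rightarrow> int \<Rightarrow> 'k iter_series" where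
  "times_t1_power x i = (\<lambda>m. case m of [] \<Rightarrow> 0 | j # m' \<Rightarrow> if j = i then x m' else 0)"

primrec laurent :: "nat \<Rightarrow> 'k::zero iter_series set" where
  "laurent 0 = {f. \<forall>m. m \<noteq> [] \<longrightarrow> f m = 0}"
| "laurent (Suc n) =
     {f. f [] = 0 \<and> (\<forall>i. coeff1 f i \<in> laurent n) \<and> (\<exists>N. \<forall>i<N. coeff1 f i = 0)}"

definition smult :: "'k::field \<Rightarrow> 'k iter_series \<Rightarrow> 'k iter_series" where
  "smult c f = (\<lambda>m. c * f m)"

text \<open>
  \<open>tlattice n [l\<^sub>1, \<dots>, l\<^sub>r]\<close> is \<open>t\<^sub>r\<^bsup>l\<^sub>r\<^esup> \<dots> t\<^sub>1\<^bsup>l\<^sub>1\<^esup> k((t\<^sub>n))\<dots>((t\<^sub>r\<^sub>+\<^sub>1))[[t\<^sub>r, \<dots>, t\<^sub>1]]\<close>.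
\<close>

definition tlattice :: "nat \<Rightarrow> int list \<Rightarrow> 'k::zero iter_series set" where
  "tlattice n ls =
     {f \<in> laurent n. \<forall>m. f m \<noteq> 0 \<longrightarrow> (\<forall>q<length ls. ls ! q \<le> m ! q)}"

text \<open>
  \<open>std_struct n d ls U W\<close> is the structure of level \<open>d\<close> on a subquotient \<open>U / W\<close> reached after
  \<open>n - d\<close> steps with numerator indices \<open>ls\<close>. The preimage in \<open>U\<close> of the image of a lattice is its
  sum with \<open>W\<close>. Larger indices give smaller subspaces, hence \<open>\<int>\<close> carries the reversed order.
\<close>

primrec std_struct ::
    "nat \<Rightarrow> nat \<Rightarrow> int list \<Rightarrow> 'k::field iter_series set \<Rightarrow> 'k iter_series set \<Rightarrow>
     (int, 'k iter_series) cn_data" where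
  "std_struct n 0 ls U W = Vect U W"
| "std_struct n (Suc d) ls U W =
     Filtered U W UNIV {(i, j). j \<le> i} (\<lambda>m. set_sum (tlattice n (ls @ [m])) W)
       (\<lambda>i j. std_struct n d (ls @ [j])
          (set_sum (tlattice n (ls @ [j])) W) (set_sum (tlattice n (ls @ [i])) W))"

definition std_laurent :: "nat \<Rightarrow> (int, 'k::field iter_series) cn_data" where
  "std_laurent n = std_struct n n [] (laurent n) {0}"

definition End_k :: "nat \<Rightarrow> ('k::field iter_series \<Rightarrow> 'k iter_series) set" where
  "End_k n = hom_quotient smult smult (laurent n) {0} (laurent n) {0}"

definition End_C :: "nat \<Rightarrow> ('k::field iter_series \<Rightarrow> 'k iter_series) set" where
  "End_C n = cn_mor smult smult n (std_laurent n) (std_laurent n)"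

text \<open>\<open>matrix_entry A i j\<close> is \<open>A\<^sub>i\<^sub>j\<close>, so that \<open>A (x t\<^sub>1\<^bsup>i\<^esup>) = \<Sum>\<^sub>j A\<^sub>i\<^sub>j(x) t\<^sub>1\<^bsup>j\<^esup>\<close>.\<close>

definition matrix_entry ::
    "('k::zero iter_series \<Rightarrow> 'k iter_series) \<Rightarrow> int \<Rightarrow> int \<Rightarrow> 'k iter_series \<Rightarrow> 'k iter_series" where
  "matrix_entry A i j x = coeff1 (A (times_t1_power x i)) j"

text \<open>
  \<open>A\<close> acts through its matrix: \<open>A (\<Sum>\<^sub>i x\<^sub>i t\<^sub>1\<^bsup>i\<^esup>) = \<Sum>\<^sub>j (\<Sum>\<^sub>i A\<^sub>i\<^sub>j(x\<^sub>i)) t\<^sub>1\<^bsup>j\<^esup>\<close>, where the inner sums are finite.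
  A linear map need not have this property, see \<open>matrix_does_not_determine\<close> below.
\<close>

definition acts_by_matrix ::
    "nat \<Rightarrow> ('k::field iter_series \<Rightarrow> 'k iter_series) \<Rightarrow> bool" where
  "acts_by_matrix n A \<longleftrightarrow>
     (\<forall>f\<in>laurent n. \<forall>j.
        finite {i. matrix_entry A i j (coeff1 f i) \<noteq> 0} \<and>
        coeff1 (A f) j =
          (\<Sum>i | matrix_entry A i j (coeff1 f i) \<noteq> 0. matrix_entry A i j (coeff1 f i)))"


section \<open>The standard structure is an object of \<open>C\<^sub>n\<close>\<close>

lemma vector_space_smult: "vector_space (smult :: 'k::field \<Rightarrow> _)"
  by unfold_locales (auto simp: smult_def fun_eq_iff algebra_simps)

interpretation fs: vector_space "smult :: 'k::field \<Rightarrow> 'k iter_series \<Rightarrow> _"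
  by (rule vector_space_smult)

interpretation fsp: vector_space_pair
  "smult :: 'k::field \<Rightarrow> 'k iter_series \<Rightarrow> _" "smult :: 'k::field \<Rightarrow> 'k iter_series \<Rightarrow> _"
  by unfold_locales

lemma coeff1_simps [simp]:
  "coeff1 0 i = 0" "coeff1 (f + g) i = coeff1 f i + coeff1 g i"
  "coeff1 (smult c h) i = smult c (coeff1 h i)"
  by (auto simp: coeff1_def smult_def fun_eq_iff)

lemma laurent_add: "f \<in> laurent n \<Longrightarrow> g \<in> laurent n \<Longrightarrow> f + g \<in> laurent n"
  for f g :: "'k::field iter_series"
proof (induction n arbitrary: f g)
  case (Suc n)
  from Suc.prems obtain N M where
    "\<forall>i<N. coeff1 f i = 0" "\<forall>i<M. coeff1 g i = 0" by auto
  then have "\<forall>i<min N M. coeff1 (f + g) i = 0" by simp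
  moreover have "coeff1 (f + g) i \<in> laurent n" for i
    using Suc.prems by (auto intro!: Suc.IH simp del: plus_fun_def)
  moreover have "(f + g) [] = 0" using Suc.prems by simp
  ultimately show ?case unfolding laurent.simps by blast
qed auto

lemma laurent_smult: "f \<in> laurent n \<Longrightarrow> smult c f \<in> laurent n"
  for f :: "'k::field iter_series"
proof (induction n arbitrary: f)
  case (Suc n)
  then show ?case by (auto intro!: exI simp: smult_def[of c 0] fun_eq_iff) (auto simp: smult_def)
qed (auto simp: smult_def)

lemma laurent_zero: "0 \<in> (laurent n :: 'k::zero iter_series set)"
  by (induction n) (auto simp: coeff1_def zero_fun_def)

lemma laurent_length: "f \<in> laurent n \<Longrightarrow> f m \<noteq> 0 \<Longrightarrow> length m = n"
proof (induction n arbitrary: f m)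
  case (Suc n)
  then obtain i m' where m: "m = i # m'" by (cases m) auto
  with Suc.IH[of "coeff1 f i" m'] Suc.prems show ?case by (auto simp: coeff1_def)
qed auto

lemma laurent_restrict:
  "f \<in> laurent n \<Longrightarrow> (\<lambda>m. if m \<in> S then f m else 0) \<in> laurent n"
proof (induction n arbitrary: f S)
  case (Suc n)
  have c: "coeff1 (\<lambda>m. if m \<in> S then f m else 0) i =
      (\<lambda>m. if m \<in> {m. i # m \<in> S} then coeff1 f i m else 0)" for i
    by (auto simp: coeff1_def)
  moreover obtain N where "\<forall>i<N. coeff1 f i = 0" using Suc.prems by auto
  ultimately have "\<forall>i<N. coeff1 (\<lambda>m. if m \<in> S then f m else 0) i = 0"
    by (simp add: fun_eq_iff)
  moreover have "coeff1 (\<lambda>m. if m \<in> S then f m else 0) i \<in> laurent n" for i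
    unfolding c using Suc.prems by (intro Suc.IH) auto
  ultimately show ?case using Suc.prems unfolding laurent.simps by auto
qed auto

lemma laurent_bound:
  "f \<in> laurent n \<Longrightarrow> length p < n \<Longrightarrow>
    \<exists>N. \<forall>m. take (length p) m = p \<and> f m \<noteq> 0 \<longrightarrow> N \<le> m ! length p"
proof (induction n arbitrary: f p)
  case (Suc n)
  show ?case
  proof (cases p)
    case Nil
    from Suc.prems obtain N where N: "\<forall>i<N. coeff1 f i = 0" "f [] = 0" by auto
    have "N \<le> m ! 0" if "f m \<noteq> 0" for m
    proof -
      from that N(2) obtain i m' where "m = i # m'" by (cases m) auto
      with that N(1) show ?thesis by (auto simp: coeff1_def fun_eq_iff not_less[symmetric])
    qed
    with Nil show ?thesis by auto
  next
    case (Cons i p')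
    with Suc.prems Suc.IH[of "coeff1 f i" p'] obtain N where
      N: "\<forall>m. take (length p') m = p' \<and> coeff1 f i m \<noteq> 0 \<longrightarrow> N \<le> m ! length p'" by auto
    have "N \<le> m ! length p" if "take (length p) m = p" "f m \<noteq> 0" for m
    proof -
      from that Cons obtain m' where "m = i # m'" "take (length p') m' = p'"
        by (cases m) auto
      with that N Cons show ?thesis by (auto simp: coeff1_def)
    qed
    then show ?thesis by blast
  qed
qed auto

lemma laurent_delta:
  "length m = n \<Longrightarrow> (\<lambda>l. if l = m then 1 else 0) \<in> (laurent n :: 'k::field iter_series set)"
proof (induction n arbitrary: m)
  case (Suc n)
  then obtain i m' where m: "m = i # m'" "length m' = n" by (cases m) auto
  let ?d = "\<lambda>l. if l = m then 1 else (0::'k)"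
  have c: "coeff1 ?d j = (if j = i then (\<lambda>l. if l = m' then 1 else 0) else 0)" for j
    using m by (auto simp: coeff1_def fun_eq_iff)
  have "\<forall>j<i. coeff1 ?d j = 0" using c by auto
  moreover have "coeff1 ?d j \<in> laurent n" for j
    using c Suc.IH[OF m(2)] laurent_zero[of n] by auto
  ultimately show ?case using m by auto
qed auto

definition supp_space :: "nat \<Rightarrow> int list set \<Rightarrow> 'k::field iter_series set" where
  "supp_space n S = {f \<in> laurent n. \<forall>m. f m \<noteq> 0 \<longrightarrow> m \<in> S}"

definition box :: "nat \<Rightarrow> int list \<Rightarrow> int list set" where
  "box n ls = {m. length m = n \<and> (\<forall>q<length ls. ls ! q \<le> m ! q)}"

lemma tlattice_eq: "tlattice n ls = supp_space n (box n ls)"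
  by (auto simp: tlattice_def supp_space_def box_def laurent_length)

lemma set_sum_supp_space: "set_sum (supp_space n S) (supp_space n T) = supp_space n (S \<union> T)"
  (is "?L = ?R")
proof
  show "?L \<subseteq> ?R"
  proof
    fix z assume "z \<in> ?L"
    then obtain x y where xy: "z = x + y" "x \<in> supp_space n S" "y \<in> supp_space n T"
      by (auto simp: set_sum_def)
    then show "z \<in> ?R"
      by (auto simp: supp_space_def laurent_add) (metis add.right_neutral)
  qed
  show "?R \<subseteq> ?L"
  proof
    fix f :: "'a iter_series" assume f: "f \<in> ?R"
    let ?x = "\<lambda>m. if m \<in> S then f m else 0" and ?y = "\<lambda>m. if m \<in> - S then f m else 0"
    have "f = ?x + ?y" by (auto simp: fun_eq_iff)
    moreover have "?x \<in> supp_space n S" "?y \<in> supp_space n T"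
      using f laurent_restrict[of f n S] laurent_restrict[of f n "- S"]
      by (auto simp: supp_space_def split: if_splits)
    ultimately show "f \<in> ?L" unfolding set_sum_def by blast
  qed
qed

lemma supp_space_subspace: "fs.subspace (supp_space n S)"
  unfolding fs.subspace_def supp_space_def
  by (auto simp: laurent_zero laurent_add laurent_smult) (auto simp: smult_def,
      metis add.right_neutral)

lemma supp_space_mono: "S \<subseteq> T \<Longrightarrow> supp_space n S \<subseteq> supp_space n T"
  by (auto simp: supp_space_def)

lemma supp_space_Int: "supp_space n S \<inter> supp_space n T = supp_space n (S \<inter> T)"
  by (auto simp: supp_space_def)

lemma supp_space_subquotient: "T \<subseteq> S \<Longrightarrow> subquotient smult (supp_space n S) (supp_space n T)"
  by (simp add: subquotient_def vector_space_smult supp_space_subspace supp_space_mono)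

lemma supp_space_finite_dim:
  assumes "T \<subseteq> S" "finite (S - T)" "S \<subseteq> {m. length m = n}"
  shows "finite_dim_quotient smult (supp_space n S) (supp_space n T :: 'k::field iter_series set)"
proof -
  define d :: "int list \<Rightarrow> 'k iter_series" where "d m = (\<lambda>l. if l = m then 1 else 0)" for m
  let ?B = "d ` (S - T)"
  have "?B \<subseteq> supp_space n S"
    using assms laurent_delta by (auto simp: supp_space_def d_def split: if_splits)
  moreover have "supp_space n S \<subseteq> fs.span (?B \<union> supp_space n T)"
  proof
    fix f :: "'k iter_series" assume f: "f \<in> supp_space n S"
    let ?g = "\<lambda>m. if m \<in> T then f m else 0"
    have 1: "?g \<in> supp_space n T"
      using f laurent_restrict[of f n T] by (auto simp: supp_space_def)
    have "f m = (?g + (\<Sum>p\<in>S - T. smult (f p) (d p))) m" for m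
    proof -
      have "(\<Sum>p\<in>S - T. smult (f p) (d p)) m = (\<Sum>p\<in>S - T. smult (f p) (d p) m)"
        by (induction rule: infinite_finite_induct) auto
      also have "\<dots> = (\<Sum>p\<in>S - T. if p = m then f m else 0)"
        by (intro sum.cong) (auto simp: smult_def d_def)
      also have "\<dots> = (if m \<in> S - T then f m else 0)"
        using assms by simp
      finally show ?thesis using f by (auto simp: supp_space_def)
    qed
    then have eq: "f = ?g + (\<Sum>p\<in>S - T. smult (f p) (d p))" by blast
    have "?g + (\<Sum>p\<in>S - T. smult (f p) (d p)) \<in> fs.span (?B \<union> supp_space n T)"
      using 1 by (intro fs.span_add fs.span_sum fs.span_scale fs.span_base) auto
    with eq show "f \<in> fs.span (?B \<union> supp_space n T)" by metis
  qed
  ultimately show ?thesis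
    using assms(2) unfolding finite_dim_quotient_def by blast
qed

lemma box_snoc: "box n (ls @ [i]) = box n ls \<inter> {m. i \<le> m ! length ls}"
  by (auto simp: box_def nth_append less_Suc_eq)

lemma short_exact_supp:
  assumes "S1 \<subseteq> S2" "T1 \<subseteq> T2" "S2 \<subseteq> S3" "T2 \<subseteq> T3"
    "T1 \<subseteq> S1" "S1 \<inter> T2 = T1" "S1 \<union> T2 = S2 \<inter> T3" "S2 \<union> T3 = S3"
  shows "short_exact smult smult smult (supp_space n S1) (supp_space n T1) (\<lambda>x. x)
     (supp_space n S2) (supp_space n T2) (\<lambda>x. x) (supp_space n S3)
     (supp_space n T3 :: 'k::field iter_series set)"
proof -
  have 0: "0 \<in> (supp_space n S :: 'k iter_series set)" for S
    using fs.subspace_0[OF supp_space_subspace] .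
  have *: "{x \<in> supp_space n A. x \<in> supp_space n B} = supp_space n (A \<inter> B)" for A B
    by (auto simp: supp_space_def)
  show ?thesis
    unfolding short_exact_def hom_quotient_def using assms 0
    by (auto simp: * set_sum_supp_space elim: supp_space_mono[THEN subsetD, rotated])
qed

lemma admissible_std_struct:
  assumes "n = length ls1 + d" "length ls2 = length ls1"
    "box n ls1 \<subseteq> box n ls2"
    "S1 = box n ls1 \<union> T1" "S2 = box n ls2 \<union> T2" "S3 = box n ls2 \<union> T3"
    "T1 \<subseteq> T2" "T2 \<subseteq> T3" "S1 \<inter> T2 = T1" "S1 \<union> T2 = S2 \<inter> T3"
  shows "cn_admissible smult smult smult d
     (std_struct n d ls1 (supp_space n S1) (supp_space n T1)) (\<lambda>x. x)
     (std_struct n d ls2 (supp_space n S2) (supp_space n T2)) (\<lambda>x. x)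
     (std_struct n d ls2 (supp_space n S3) (supp_space n T3 :: 'k::field iter_series set))"
  using assms
proof (induction d arbitrary: ls1 ls2 S1 S2 S3 T1 T2 T3)
  case 0
  then show ?case by (simp, intro short_exact_supp) auto
next
  case (Suc d)
  note p = Suc.prems
  have ex: "short_exact smult smult smult (supp_space n S1) (supp_space n T1) (\<lambda>x. x)
     (supp_space n S2) (supp_space n T2) (\<lambda>x. x) (supp_space n S3)
     (supp_space n T3 :: 'k::field iter_series set)"
    using p by (intro short_exact_supp) auto
  have *: "{x \<in> supp_space n A. x \<in> supp_space n B} = supp_space n (A \<inter> B)" for A B
    by (auto simp: supp_space_def)
  have d1: "box n (ls1 @ [m]) \<union> T1 = S1 \<inter> (box n (ls2 @ [m]) \<union> T2)" for m
    using p by (auto simp: box_snoc)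
  have d3: "box n (ls2 @ [m]) \<union> T3 = box n (ls2 @ [m]) \<union> T2 \<union> T3" for m
    using p by auto
  have rec: "cn_admissible smult smult smult d
     (std_struct n d (ls1 @ [j]) (supp_space n (box n (ls1 @ [j]) \<union> T1))
        (supp_space n (box n (ls1 @ [i]) \<union> T1))) (\<lambda>x. x)
     (std_struct n d (ls2 @ [j]) (supp_space n (box n (ls2 @ [j]) \<union> T2))
        (supp_space n (box n (ls2 @ [i]) \<union> T2))) (\<lambda>x. x)
     (std_struct n d (ls2 @ [j]) (supp_space n (box n (ls2 @ [j]) \<union> T3))
        (supp_space n (box n (ls2 @ [i]) \<union> T3 ) :: 'k::field iter_series set))"
    if "j \<le> i" for i j
  proof (rule Suc.IH)
    have G: "{m::int list. i \<le> m ! length ls1} \<subseteq> {m. j \<le> m ! length ls1}" using that by auto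
    show "box n (ls1 @ [j]) \<union> T1 = box n (ls1 @ [j]) \<union> (box n (ls1 @ [i]) \<union> T1)"
      "box n (ls2 @ [j]) \<union> T2 = box n (ls2 @ [j]) \<union> (box n (ls2 @ [i]) \<union> T2)"
      "box n (ls2 @ [j]) \<union> T3 = box n (ls2 @ [j]) \<union> (box n (ls2 @ [i]) \<union> T3)"
      using G p(2) by (auto simp: box_snoc)
    show "(box n (ls1 @ [j]) \<union> T1) \<inter> (box n (ls2 @ [i]) \<union> T2) = box n (ls1 @ [i]) \<union> T1"
      unfolding box_snoc p(2) using G p(3-) by blast
    show "box n (ls1 @ [j]) \<union> T1 \<union> (box n (ls2 @ [i]) \<union> T2) =
      (box n (ls2 @ [j]) \<union> T2) \<inter> (box n (ls2 @ [i]) \<union> T3)"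
      unfolding box_snoc p(2) using G p(3-) by blast
  qed (use p in \<open>auto simp: box_snoc\<close>)
  show ?case
    unfolding cn_admissible.simps
  proof (intro conjI exI[of _ "\<lambda>x. x"] allI impI, goal_cases)
    case 1
    then show ?case using ex by simp
  next
    case 2
    then show ?case using d1 by (auto simp: dominates_via_def tlattice_eq set_sum_supp_space *)
  next
    case 3
    then show ?case using d3 by (auto simp: dominates_via_def tlattice_eq set_sum_supp_space)
  next
    case (4 i j)
    then show ?case using rec[of j i] by (simp add: tlattice_eq set_sum_supp_space)
  qed
qed

lemma object_std_struct:
  assumes "n = length ls + d" "finite (take (length ls) ` (box n ls - T))"
    "T \<subseteq> {m. length m = n}"
  shows "cn_object smult d
     (std_struct n d ls (supp_space n (box n ls \<union> T)) (supp_space n T :: 'k::field iter_series set))"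
  using assms
proof (induction d arbitrary: ls T)
  case 0
  have "finite (box n ls - T)"
  proof -
    have "take (length ls) ` (box n ls - T) = box n ls - T"
      using 0 by (auto simp: box_def image_iff)
    with 0 show ?thesis by simp
  qed
  then show ?case
    using 0 by (auto intro!: supp_space_subquotient supp_space_finite_dim simp: Un_Diff box_def)
next
  case (Suc d)
  let ?r = "length ls"
  let ?F = "\<lambda>m. supp_space n (box n (ls @ [m]) \<union> T) :: 'k iter_series set"
  have F: "set_sum (tlattice n (ls @ [m])) (supp_space n T) = ?F m" for m
    by (simp add: tlattice_eq set_sum_supp_space)
  have inter: "(\<Inter>m. ?F m) = supp_space n T"
  proof (intro equalityI subsetI)
    fix f assume f: "f \<in> (\<Inter>m. ?F m)"
    have "m \<in> T" if "f m \<noteq> 0" for m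
    proof (rule ccontr)
      assume "m \<notin> T"
      moreover have "m \<in> box n (ls @ [m ! ?r + 1]) \<union> T"
        using f that by (auto simp: supp_space_def)
      ultimately show False by (auto simp: box_snoc)
    qed
    with f show "f \<in> supp_space n T" by (auto simp: supp_space_def)
  qed (auto simp: supp_space_def)
  have union: "(\<Union>m. ?F m) = supp_space n (box n ls \<union> T)"
  proof (intro equalityI subsetI)
    fix f :: "'k iter_series" assume f: "f \<in> supp_space n (box n ls \<union> T)"
    let ?Q = "take ?r ` (box n ls - T)"
    have "\<forall>p\<in>?Q. \<exists>N. \<forall>m. take ?r m = p \<and> f m \<noteq> 0 \<longrightarrow> N \<le> m ! ?r"
    proof
      fix p assume "p \<in> ?Q"
      then have "length p = ?r" using Suc.prems(1) by (auto simp: box_def)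
      with laurent_bound[of f n p] f Suc.prems(1)
      show "\<exists>N. \<forall>m. take ?r m = p \<and> f m \<noteq> 0 \<longrightarrow> N \<le> m ! ?r" by (simp add: supp_space_def)
    qed
    then obtain N where N: "\<forall>p\<in>?Q. \<forall>m. take ?r m = p \<and> f m \<noteq> 0 \<longrightarrow> N p \<le> m ! ?r"
      by metis
    define M where "M = Min (insert 0 (N ` ?Q))"
    have M: "M \<le> N p" if "p \<in> ?Q" for p
      unfolding M_def using Suc.prems(2) that by (intro Min_le) auto
    have "f \<in> ?F M"
    proof -
      have "m \<in> box n (ls @ [M]) \<union> T" if "f m \<noteq> 0" for m
      proof (cases "m \<in> T")
        case False
        with f that have mb: "m \<in> box n ls - T" by (auto simp: supp_space_def)
        then have q: "take ?r m \<in> ?Q" by blast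
        from N q that have "N (take ?r m) \<le> m ! ?r" by blast
        with M[OF q] mb show ?thesis by (auto simp: box_snoc)
      qed auto
      with f show ?thesis by (auto simp: supp_space_def)
    qed
    then show "f \<in> (\<Union>m. ?F m)" by blast
  qed (auto simp: supp_space_def box_snoc)
  have mono: "?F i \<subseteq> ?F j" if "j \<le> i" for i j
    using that by (intro supp_space_mono) (auto simp: box_snoc)
  have fin: "finite (take (length (ls @ [j])) ` (box n (ls @ [j]) - (box n (ls @ [i]) \<union> T)))"
    (is "finite ?X") for i j
  proof -
    have "?X \<subseteq> (\<lambda>(p, x). p @ [x]) ` (take ?r ` (box n ls - T) \<times> {j..i})"
    proof
      fix y assume "y \<in> ?X"
      then obtain m where m: "m \<in> box n (ls @ [j])" "m \<notin> box n (ls @ [i])" "m \<notin> T"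
        "y = take (Suc ?r) m" by auto
      then have "m \<in> box n ls" "j \<le> m ! ?r" "m ! ?r \<le> i"
        unfolding box_snoc by auto
      moreover from this have "length m = n" by (simp add: box_def)
      moreover from this m have "y = take ?r m @ [m ! ?r]"
        using Suc.prems(1) by (simp add: take_Suc_conv_app_nth)
      ultimately show "y \<in> (\<lambda>(p, x). p @ [x]) ` (take ?r ` (box n ls - T) \<times> {j..i})"
        using m by (intro image_eqI[of _ _ "(take ?r m, m ! ?r)"]) auto
    qed
    then show ?thesis by (rule finite_subset) (use Suc.prems(2) in auto)
  qed
  have "filtered_space smult (supp_space n (box n ls \<union> T)) (supp_space n T) UNIV {(i, j). j \<le> i} ?F"
    unfolding filtered_space_def inter union
  proof (intro conjI ballI allI impI, goal_cases)
    case 2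
    then show ?case
      by (auto simp: partial_order_on_def preorder_on_def refl_on_def trans_def antisym_def)
  next
    case (3 i j)
    then show ?case by (intro bexI[of _ "max i j"] bexI[of _ "min i j"]) auto
  next
    case 1
    show ?case by (rule supp_space_subquotient) auto
  next
    case (4 i)
    show ?case by (rule supp_space_subspace)
  next
    case (5 i)
    show ?case by (rule supp_space_mono) auto
  next
    case (6 i)
    show ?case by (rule supp_space_mono) (auto simp: box_snoc)
  next
    case (7 i j)
    then show ?case using mono by simp
  qed simp_all
  moreover have "cn_object smult d (std_struct n d (ls @ [j]) (?F j) (?F i))"
    if "j \<le> i" for i j
  proof -
    have "box n (ls @ [j]) \<union> T = box n (ls @ [j]) \<union> (box n (ls @ [i]) \<union> T)"
      using that by (auto simp: box_snoc)
    moreover have "cn_object smult d (std_struct n d (ls @ [j])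
        (supp_space n (box n (ls @ [j]) \<union> (box n (ls @ [i]) \<union> T))) (?F i))"
      using Suc.prems fin[of j i] by (intro Suc.IH) (auto simp: box_def)
    ultimately show ?thesis by simp
  qed
  moreover have "cn_admissible smult smult smult d
      (std_struct n d (ls @ [j]) (?F j) (?F i)) (\<lambda>x. x)
      (std_struct n d (ls @ [l]) (?F l) (?F i)) (\<lambda>x. x)
      (std_struct n d (ls @ [l]) (?F l) (?F j))"
    if "j \<le> i" "l \<le> j" for i j l
    using that Suc.prems(1) by (intro admissible_std_struct) (auto simp: box_snoc)
  moreover have "upper (std_struct n d ks U W) = U" "lower (std_struct n d ks U W) = W"
    for ks and U W :: "'k iter_series set"
    by (cases d; simp)+
  ultimately show ?case by (simp add: F)
qed

lemma std_laurent_object: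
  "cn_object smult n (std_laurent n :: (int, 'k::field iter_series) cn_data)"
proof -
  have "supp_space n (box n [] \<union> {}) = (laurent n :: 'k iter_series set)"
    by (auto simp: supp_space_def box_def laurent_length)
  moreover have "supp_space n {} = ({0} :: 'k iter_series set)"
    by (auto simp: supp_space_def fun_eq_iff laurent_zero)
  moreover have "cn_object smult n (std_struct n n [] (supp_space n (box n [] \<union> {}))
      (supp_space n {} :: 'k iter_series set))"
    by (rule object_std_struct) (auto intro: finite_subset[of _ "{[]}"])
  ultimately show ?thesis unfolding std_laurent_def by simp
qed


section \<open>The matrix alone does not determine a linear map\<close>

text \<open>
  A linear endomorphism of \<open>k((t\<^sub>1))\<close> whose matrix vanishes and which is not in \<open>End\<^sub>K\<close>.
\<close>

lemma matrix_does_not_determine: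
  "\<exists>A \<in> (End_k 1 :: ('k::field iter_series \<Rightarrow> 'k iter_series) set).
     (\<forall>i j. \<forall>x\<in>laurent 0. matrix_entry A i j x = 0) \<and>
     (\<forall>i j. matrix_entry A i j \<in> End_C 0) \<and> A \<notin> End_C 1"
proof -
  define W :: "'k iter_series set" where "W = {f. finite {m. f m \<noteq> 0}}"
  define g :: "int \<Rightarrow> 'k iter_series" where
    "g i = (\<lambda>m. case m of [j] \<Rightarrow> if i \<le> j then 1 else 0 | _ \<Rightarrow> 0)" for i
  define d :: "'k iter_series" where "d = (\<lambda>m. if m = [0] then 1 else 0)"
  have subW: "fs.subspace W"
  proof (rule fs.subspaceI)
    fix x y assume "x \<in> W" "y \<in> W"
    then have "finite ({m. x m \<noteq> 0} \<union> {m. y m \<noteq> 0})" by (simp add: W_def)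
    then have "finite {m. (x + y) m \<noteq> 0}" by (rule rev_finite_subset) auto
    then show "x + y \<in> W" unfolding W_def by blast
  next
    fix c x assume "x \<in> W"
    then have "finite {m. x m \<noteq> 0}" by (simp add: W_def)
    then have "finite {m. smult c x m \<noteq> 0}" by (rule rev_finite_subset) (auto simp: smult_def)
    then show "smult c x \<in> W" unfolding W_def by blast
  qed (simp add: W_def)
  obtain B where B: "B \<subseteq> W" "fs.independent B" "W \<subseteq> fs.span B"
    by (rule fs.basis_exists[of W])
  have spanB: "fs.span B = W"
    using B subW by (metis fs.span_minimal subset_antisym)
  have "g 0 \<notin> W"
  proof
    assume "g 0 \<in> W"
    then have "finite {m. g 0 m \<noteq> 0}" by (simp add: W_def)
    moreover have "(\<lambda>i. [i]) ` {0::int..} \<subseteq> {m. g 0 m \<noteq> 0}" by (auto simp: g_def)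
    ultimately have "finite ((\<lambda>i. [i]) ` {0::int..})" by (rule rev_finite_subset)
    then have "finite {0::int..}" by (rule finite_imageD) (auto simp: inj_on_def)
    then show False by (simp add: infinite_Ici)
  qed
  then have ind: "fs.independent (insert (g 0) B)" and gB: "g 0 \<notin> B"
    using B(1,2) spanB by (auto simp: fs.independent_insert)
  obtain \<phi> where \<phi>: "Vector_Spaces.linear smult smult \<phi>"
    "\<forall>x\<in>insert (g 0) B. \<phi> x = (if x = g 0 then d else 0)"
    using fsp.linear_independent_extend[OF ind, of "\<lambda>x. if x = g 0 then d else 0"] by blast
  have \<phi>_add: "\<phi> (x + y) = \<phi> x + \<phi> y" and \<phi>_smult: "\<phi> (smult c x) = smult c (\<phi> x)" for x y c
    by (rule fsp.linear_add[OF \<phi>(1)], rule fsp.linear_scale[OF \<phi>(1)])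
  have \<phi>W: "\<phi> x = 0" if "x \<in> W" for x
  proof (rule fsp.linear_eq_0_on_span[OF \<phi>(1)])
    show "\<phi> b = 0" if "b \<in> B" for b
    proof -
      from that gB have "b \<noteq> g 0" by blast
      with \<phi>(2) that show ?thesis by simp
    qed
    show "x \<in> fs.span B" using that spanB by simp
  qed
  have \<phi>g: "\<phi> (g i) = d" for i
  proof -
    have "{m. (g i - g 0) m \<noteq> 0} \<subseteq> (\<lambda>j. [j]) ` {min i 0..max i 0}"
    proof
      fix m assume m: "m \<in> {m. (g i - g 0) m \<noteq> 0}"
      show "m \<in> (\<lambda>j. [j]) ` {min i 0..max i 0}"
        using m by (cases m; cases "tl m") (auto simp: g_def split: if_splits)
    qed
    then have "g i - g 0 \<in> W" unfolding W_def mem_Collect_eq by (rule finite_subset) simp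
    then have "\<phi> (g 0 + (g i - g 0)) = \<phi> (g 0)" by (simp only: \<phi>_add \<phi>W add_0_right)
    moreover have "g 0 + (g i - g 0) = g i" by (simp add: fun_eq_iff)
    moreover have "\<phi> (g 0) = d" using \<phi>(2) by simp
    ultimately show ?thesis by metis
  qed
  define A :: "'k iter_series \<Rightarrow> 'k iter_series" where "A x = smult (\<phi> x [0]) d" for x
  have d1: "d \<in> laurent 1" unfolding d_def by (rule laurent_delta) simp
  have A_in: "A x \<in> laurent 1" for x unfolding A_def by (rule laurent_smult[OF d1])
  have A0: "A 0 = 0"
    unfolding A_def using \<phi>W[of 0] by (simp add: W_def smult_def fun_eq_iff)
  have A_add: "A (x + y) = A x + A y" for x y
    unfolding A_def \<phi>_add by (simp add: smult_def fun_eq_iff algebra_simps)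
  have A_smult: "A (smult c x) = smult c (A x)" for x c
    unfolding A_def \<phi>_smult by (simp add: smult_def fun_eq_iff algebra_simps)
  have "A \<in> End_k 1"
    unfolding End_k_def hom_quotient_def mem_Collect_eq A_add A_smult diff_self
    using A_in A0 by blast
  moreover have M: "matrix_entry A i j x = 0" if "x \<in> laurent 0" for i j x
  proof -
    have "{m. times_t1_power x i m \<noteq> 0} \<subseteq> {[i]}"
    proof
      fix m assume "m \<in> {m. times_t1_power x i m \<noteq> 0}"
      with that show "m \<in> {[i]}"
        by (cases m) (auto simp: times_t1_power_def split: if_splits)
    qed
    then have "times_t1_power x i \<in> W"
      unfolding W_def mem_Collect_eq by (rule finite_subset) simp
    then show ?thesis using \<phi>W by (simp add: matrix_entry_def A_def coeff1_def smult_def fun_eq_iff)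
  qed
  moreover have "matrix_entry A i j \<in> End_C 0" for i j
  proof -
    have "0 \<in> (laurent 0 :: 'k iter_series set)" by (rule laurent_zero)
    moreover have "x + y \<in> laurent 0" "smult c x \<in> laurent 0"
      if "x \<in> laurent 0" "y \<in> laurent 0" for x y :: "'k iter_series" and c
      using that laurent_add laurent_smult by blast+
    ultimately show ?thesis
      unfolding End_C_def std_laurent_def hom_quotient_def cn_mor.simps std_struct.simps cn_data.sel
      by (simp add: M image_subset_iff)
  qed
  moreover have "A \<notin> End_C 1"
  proof
    assume "A \<in> End_C 1"
    then have "\<forall>j. \<exists>i. A ` set_sum (tlattice 1 [i]) {0} \<subseteq> set_sum (tlattice 1 [j]) {0}"
      by (simp add: End_C_def std_laurent_def)
    then obtain i where i: "A ` set_sum (tlattice 1 [i]) {0} \<subseteq> set_sum (tlattice 1 [1]) {0}"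
      by blast
    have c: "coeff1 (g i) j = (if i \<le> j then (\<lambda>m. if m = [] then 1 else 0) else 0)" for j
      by (auto simp: coeff1_def g_def fun_eq_iff split: list.splits)
    have "g i \<in> laurent 1"
      unfolding One_nat_def laurent.simps mem_Collect_eq
      by (intro conjI allI exI[of _ i]) (auto simp: c, auto simp: g_def)
    then have "g i \<in> tlattice 1 [i]"
      unfolding tlattice_def mem_Collect_eq
    proof (intro conjI allI impI)
      fix m q assume "g i m \<noteq> 0" "q < length [i]"
      then show "[i] ! q \<le> m ! q"
        by (cases m; cases "tl m") (auto simp: g_def split: if_splits)
    qed
    then have "g i \<in> set_sum (tlattice 1 [i]) {0}" by (auto simp: set_sum_def)
    with i have "A (g i) \<in> tlattice 1 [1]" by (auto simp: set_sum_def)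
    moreover have "A (g i) [0] \<noteq> 0" by (simp add: A_def \<phi>g smult_def d_def)
    ultimately show False by (auto simp: tlattice_def)
  qed
  ultimately show ?thesis by blast
qed

end

theory Submission
  imports Defs
begin

text \<open>
  After \<open>r\<close> steps a subquotient of \<open>K\<close> is a finite direct sum of copies of \<open>k((t\<^sub>n))\<dots>((t\<^sub>r\<^sub>+\<^sub>1))\<close>, indexed
  by exponents of \<open>t\<^sub>1, \<dots>, t\<^sub>r\<close>. By induction on the level, a linear map between two such sums is a
  morphism if and only if each block of its finite matrix is one: conditions (1) and (2) hold for the
  map if and only if they hold for every block, since only finitely many indices have to be compared;
  and every pair of exponents of \<open>t\<^sub>r\<^sub>+\<^sub>1\<close> lies in suitable windows as in condition (3), so that (3) says
  that the blocks of the next level are morphisms. For \<open>K\<close> itself, conditions (1) and (2) amount to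
  the existence of \<open>a\<close> together with the finiteness that makes \<open>A\<close> act by its matrix.
\<close>

section \<open>Blocks of a linear map\<close>

text \<open>Multiplication by the monomial with exponent list \<open>p\<close> in the first
  \<open>length p\<close> variables; \<open>coeff_at p\<close> takes the coefficient of that
  monomial. They serve as inclusions and projections of the summands, so that \<open>block\<close>
  is a matrix entry.\<close>

definition place :: "int list \<Rightarrow> 'k::zero iter_series \<Rightarrow> 'k iter_series" where
  "place p x = (\<lambda>m. if take (length p) m = p then x (drop (length p) m) else 0)"

definition coeff_at :: "int list \<Rightarrow> 'k iter_series \<Rightarrow> 'k iter_series" where
  "coeff_at p f = (\<lambda>m. f (p @ m))"

definition block ::
    "('k::zero iter_series \<Rightarrow> 'k iter_series) \<Rightarrow> int list \<Rightarrow> int list \<Rightarrow> 'k iter_series \<Rightarrow> 'k iter_series" where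
  "block f p q x = coeff_at q (f (place p x))"

lemma place_Nil [simp]: "place [] x = x"
  by (simp add: place_def)

lemma coeff_at_Nil [simp]: "coeff_at [] x = x"
  by (simp add: coeff_at_def)

lemma place_Cons: "place (a # p) x = times_t1_power (place p x) a"
  by (auto simp: place_def times_t1_power_def fun_eq_iff split: list.splits)

lemma place_append: "place (p @ q) x = place p (place q x)"
  by (induction p) (simp_all add: place_Cons)

lemma coeff_at_append: "coeff_at (p @ q) f = coeff_at q (coeff_at p f)"
  by (simp add: coeff_at_def)

lemma coeff_at_Cons: "coeff_at (a # p) f = coeff_at p (coeff1 f a)"
  by (simp add: coeff_at_def coeff1_def)

text \<open>Blocks of blocks are blocks of the original map. This lets the induction add one
  variable at a time.\<close>

lemma block_append: "block f (p @ p') (q @ q') = block (block f p q) p' q'"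
  by (simp add: block_def place_append coeff_at_append fun_eq_iff)

lemma block_singleton: "block f [i] [j] = matrix_entry f i j"
  by (simp add: block_def matrix_entry_def place_Cons coeff_at_Cons fun_eq_iff)

lemma coeff_at_linear [simp]:
  "coeff_at p 0 = 0" "coeff_at p (f + g) = coeff_at p f + coeff_at p g"
  "coeff_at p (f' - g') = coeff_at p f' - coeff_at p g'"
  "coeff_at p (smult c h) = smult c (coeff_at p h)"
  by (auto simp: coeff_at_def smult_def fun_eq_iff)

lemma coeff_at_sum: "coeff_at p (\<Sum>i\<in>A. f i) = (\<Sum>i\<in>A. coeff_at p (f i))"
  for f :: "_ \<Rightarrow> 'k::field iter_series"
  using sum_comp_morphism[of "coeff_at p :: 'k iter_series \<Rightarrow> _" f A] by (simp add: comp_def)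

lemma place_linear:
  "place p 0 = 0" "place p (x + y) = place p x + place p y"
  "place p (smult c z) = smult c (place p z)"
  for x y :: "'k::field iter_series"
  by (auto simp: place_def smult_def fun_eq_iff)

text \<open>Equal lengths matter: if one list is a proper prefix of the other, the coefficient need
  not vanish although the lists differ.\<close>

lemma coeff_at_place:
  "length p = length q \<Longrightarrow> coeff_at q (place p x) = (if p = q then x else 0)"
  by (auto simp: coeff_at_def place_def fun_eq_iff)

section \<open>Laurent series under monomial multiplication and coefficient extraction\<close>

lemma coeff1_times_t1_power: "coeff1 (times_t1_power x i) j = (if j = i then x else 0)"
  by (auto simp: coeff1_def times_t1_power_def fun_eq_iff)

lemma laurent_times_t1_power:
  assumes "x \<in> laurent n"
  shows "times_t1_power x i \<in> laurent (Suc n)"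
proof -
  have "\<forall>j<i. coeff1 (times_t1_power x i) j = 0" by (simp add: coeff1_times_t1_power)
  moreover have "coeff1 (times_t1_power x i) j \<in> laurent n" for j
    using assms laurent_zero by (auto simp: coeff1_times_t1_power)
  ultimately show ?thesis by (auto simp: times_t1_power_def)
qed

lemma laurent_place: "x \<in> laurent d \<Longrightarrow> place p x \<in> laurent (length p + d)"
  by (induction p) (simp_all add: place_Cons laurent_times_t1_power del: laurent.simps)

lemma laurent_coeff_at: "f \<in> laurent (length p + d) \<Longrightarrow> coeff_at p f \<in> laurent d"
  by (induction p arbitrary: f) (simp_all add: coeff_at_Cons)

lemma laurent_0_iff: "f \<in> laurent n \<Longrightarrow> f = 0 \<longleftrightarrow> (\<forall>m. length m = n \<longrightarrow> f m = 0)"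
  using laurent_length[of f n] by (auto simp: fun_eq_iff)

text \<open>The index \<open>Q\<close> lists the finitely many summands \<open>k((t\<^sub>n))\<dots>((t\<^sub>r\<^sub>+\<^sub>1))\<close>, \<open>r = n - d\<close>, of a subquotient
  reached after \<open>r\<close> steps.\<close>

definition block_shape :: "nat \<Rightarrow> nat \<Rightarrow> int list \<Rightarrow> int list set \<Rightarrow> int list set \<Rightarrow> bool" where
  "block_shape n d ls T Q \<longleftrightarrow> n = length ls + d \<and> finite Q \<and> (\<forall>q\<in>Q. length q = length ls) \<and>
     box n ls - T = {q @ m | q m. q \<in> Q \<and> length m = d}"

text \<open>The denominator is given by an arbitrary set \<open>T\<close> of exponents. With
  numerator \<open>box n ls \<union> T\<close> the family is closed under the subquotients of the
  filtration.\<close>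

definition std_block ::
    "nat \<Rightarrow> nat \<Rightarrow> int list \<Rightarrow> int list set \<Rightarrow> (int, 'k::field iter_series) cn_data" where
  "std_block n d ls T = std_struct n d ls (supp_space n (box n ls \<union> T)) (supp_space n T)"

lemma supp_space_whole:
  "supp_space n (box n [] \<union> {}) = (laurent n :: 'k::field iter_series set)"
  "supp_space n {} = ({0} :: 'k::field iter_series set)"
  by (auto simp: supp_space_def box_def laurent_length fun_eq_iff laurent_zero)

lemma std_laurent_eq: "std_laurent n = (std_block n n [] {} :: (int, 'k::field iter_series) cn_data)"
  by (simp only: std_laurent_def std_block_def supp_space_whole)

lemma std_block_sel [simp]:
  "upper (std_block n d ls T) = supp_space n (box n ls \<union> T)"
  "lower (std_block n d ls T) = supp_space n T"
  by (cases d; simp add: std_block_def)+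

lemma std_block_Suc_sel:
  "index (std_block n (Suc d) ls T) = UNIV"
  "index_le (std_block n (Suc d) ls T) = {(i, j). j \<le> i}"
  "filt (std_block n (Suc d) ls T) i = supp_space n (box n (ls @ [i]) \<union> T)"
  by (simp_all add: std_block_def tlattice_eq set_sum_supp_space)

text \<open>Since \<open>j \<le> i\<close>, the lattice of index \<open>i\<close> lies in that of
  index \<open>j\<close>, so adding the new denominator leaves the numerator unchanged.\<close>

lemma quot_std_block:
  assumes "j \<le> i"
  shows "quot (std_block n (Suc d) ls T) i j = std_block n d (ls @ [j]) (box n (ls @ [i]) \<union> T)"
proof -
  have "box n (ls @ [j]) \<union> (box n (ls @ [i]) \<union> T) = box n (ls @ [j]) \<union> T"
    using assms by (auto simp: box_snoc)
  then show ?thesis by (simp add: std_block_def tlattice_eq set_sum_supp_space)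
qed

lemma block_shape_whole: "block_shape n n [] {} {[]}"
  by (auto simp: block_shape_def box_def)

text \<open>Each summand splits according to the exponent \<open>a\<close> of the next variable. The
  window is half-open because exponents from \<open>i\<close> on are divided out.\<close>

lemma block_shape_quot:
  assumes "block_shape n (Suc d) ls T Q" "j \<le> i"
  shows "block_shape n d (ls @ [j]) (box n (ls @ [i]) \<union> T) ((\<lambda>(q, a). q @ [a]) ` (Q \<times> {j..<i}))"
    (is "block_shape _ _ _ _ ?Q")
proof -
  let ?r = "length ls"
  from assms have n: "n = ?r + Suc d" and fin: "finite Q" and len: "\<And>q. q \<in> Q \<Longrightarrow> length q = ?r"
    and Q: "box n ls - T = {q @ m | q m. q \<in> Q \<and> length m = Suc d}"
    unfolding block_shape_def by blast+
  have "box n (ls @ [j]) - (box n (ls @ [i]) \<union> T) = {m \<in> box n ls - T. j \<le> m ! ?r \<and> m ! ?r < i}"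
    by (auto simp: box_snoc)
  also have "\<dots> = {q @ m | q m. q \<in> ?Q \<and> length m = d}" (is "?L = ?R")
  proof (intro equalityI subsetI)
    fix m assume "m \<in> ?L"
    then obtain q m' where "m = q @ m'" "q \<in> Q" "length m' = Suc d" "j \<le> m ! ?r" "m ! ?r < i"
      unfolding Q by blast
    moreover from this obtain a m'' where "m' = a # m''" by (cases m') auto
    ultimately have "m = (q @ [a]) @ m''" "q @ [a] \<in> ?Q" "length m'' = d"
      using len[of q] by (auto simp: nth_append intro!: image_eqI[of _ _ "(q, a)"])
    then show "m \<in> ?R" by blast
  next
    fix m assume "m \<in> ?R"
    then obtain q a m'' where "m = q @ a # m''" "q \<in> Q" "j \<le> a" "a < i" "length m'' = d" by auto
    moreover from this have "length (a # m'') = Suc d" "m ! ?r = a"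
      using len[of q] by (auto simp: nth_append)
    moreover from calculation have "m \<in> box n ls - T" unfolding Q by blast
    ultimately show "m \<in> ?L" by simp
  qed
  finally show ?thesis using n fin len unfolding block_shape_def by auto
qed

section \<open>Decomposition of a subquotient into finitely many Laurent series spaces\<close>

context
  fixes n d ls T Q
  assumes shape: "block_shape n d ls T Q"
begin

lemma shape_facts:
  shows shape_length: "n = length ls + d" and shape_finite: "finite Q"
    and shape_index: "q \<in> Q \<Longrightarrow> length q = length ls"
    and shape_mem: "q \<in> Q \<Longrightarrow> length m = d \<Longrightarrow> q @ m \<in> box n ls - T"
    and shape_ex: "m \<in> box n ls \<Longrightarrow> m \<notin> T \<Longrightarrow> \<exists>q\<in>Q. \<exists>m'. length m' = d \<and> m = q @ m'"
  using shape unfolding block_shape_def by blast+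

lemma coeff_at_in_laurent: "q \<in> Q \<Longrightarrow> x \<in> supp_space n S \<Longrightarrow> coeff_at q x \<in> laurent d"
  using laurent_coeff_at[of x q d] shape_length shape_index by (auto simp: supp_space_def)

text \<open>No exponent of length \<open>n\<close> that extends \<open>q\<close> lies in
  \<open>T\<close>. Hence the coefficient maps are well defined on the quotient.\<close>

lemma coeff_at_lower: "q \<in> Q \<Longrightarrow> y \<in> supp_space n T \<Longrightarrow> coeff_at q y = 0"
  using coeff_at_in_laurent[of q y T] shape_mem[of q]
  by (subst laurent_0_iff[of _ d]) (auto simp: coeff_at_def supp_space_def)

lemma place_upper: "q \<in> Q \<Longrightarrow> x \<in> laurent d \<Longrightarrow> place q x \<in> supp_space n (box n ls \<union> T)"
proof -
  assume q: "q \<in> Q" and x: "x \<in> laurent d"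
  have "place q x \<in> laurent n"
    using laurent_place[OF x, of q] shape_length shape_index[OF q] by simp
  moreover have "m \<in> box n ls \<union> T" if "place q x m \<noteq> 0" for m
  proof -
    from that have "take (length q) m = q" "x (drop (length q) m) \<noteq> 0"
      by (auto simp: place_def split: if_splits)
    then show ?thesis
      using shape_mem[OF q laurent_length[OF x, of "drop (length q) m"]]
      by (metis Diff_iff UnI1 append_take_drop_id)
  qed
  ultimately show ?thesis by (auto simp: supp_space_def)
qed

text \<open>Every exponent of the numerator outside \<open>T\<close> begins with some
  \<open>q\<close> in \<open>Q\<close>. Together with \<open>coeff_at_lower\<close>, the denominator
  is the common kernel of the coefficient maps.\<close>

lemma lowerI:
  assumes "y \<in> supp_space n (box n ls \<union> T)" "\<And>q. q \<in> Q \<Longrightarrow> coeff_at q y = 0"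
  shows "y \<in> supp_space n T"
proof -
  have "m \<in> T" if "y m \<noteq> 0" for m
  proof (rule ccontr)
    assume "m \<notin> T"
    moreover from this that assms(1) have "m \<in> box n ls" by (auto simp: supp_space_def)
    ultimately obtain q m' where "q \<in> Q" "m = q @ m'" using shape_ex by blast
    with assms(2) that show False by (auto simp: coeff_at_def fun_eq_iff)
  qed
  with assms(1) show ?thesis by (auto simp: supp_space_def)
qed

text \<open>By \<open>lowerI\<close> it suffices to compare coefficients, and
  \<open>coeff_at q\<close> sees only the summand with \<open>p = q\<close>.\<close>

lemma decomposition:
  assumes x: "x \<in> supp_space n (box n ls \<union> T)"
  shows "x - (\<Sum>p\<in>Q. place p (coeff_at p x)) \<in> supp_space n T"
proof (rule lowerI)
  show "x - (\<Sum>p\<in>Q. place p (coeff_at p x)) \<in> supp_space n (box n ls \<union> T)"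
    by (intro fs.subspace_diff[OF supp_space_subspace] fs.subspace_sum[OF supp_space_subspace]
        x place_upper coeff_at_in_laurent[OF _ x])
next
  fix q assume q: "q \<in> Q"
  have "(\<Sum>p\<in>Q. coeff_at q (place p (coeff_at p x))) = (\<Sum>p\<in>Q. if q = p then coeff_at p x else 0)"
    using q shape_index by (intro sum.cong refl) (simp add: coeff_at_place)
  then show "coeff_at q (x - (\<Sum>p\<in>Q. place p (coeff_at p x))) = 0"
    using q shape_finite by (simp add: coeff_at_sum)
qed

end

text \<open>The new bound concerns position \<open>length ls\<close>, which becomes position 0 once
  the prefix \<open>q\<close> is removed. Exponents in \<open>T\<close> are unrestricted and
  invisible to the coefficients.\<close>

lemma tlattice_snoc_iff:
  assumes "block_shape n (Suc d) ls T Q" "y \<in> supp_space n (box n ls \<union> T)"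
  shows "y \<in> supp_space n (box n (ls @ [j]) \<union> T) \<longleftrightarrow>
    (\<forall>q\<in>Q. coeff_at q y \<in> tlattice (Suc d) [j])"
proof
  note sh = shape_facts[OF assms(1)]
  assume y: "y \<in> supp_space n (box n (ls @ [j]) \<union> T)"
  show "\<forall>q\<in>Q. coeff_at q y \<in> tlattice (Suc d) [j]"
  proof
    fix q assume q: "q \<in> Q"
    have l: "coeff_at q y \<in> laurent (Suc d)"
      by (rule coeff_at_in_laurent[OF assms(1) q assms(2)])
    have "j \<le> m ! 0" if m: "coeff_at q y m \<noteq> 0" for m
    proof -
      have len: "length m = Suc d" using laurent_length[OF l m] .
      from m y sh(4)[OF q len] have "q @ m \<in> box n (ls @ [j])"
        by (auto simp: coeff_at_def supp_space_def)
      then have "j \<le> (q @ m) ! length ls" by (simp add: box_snoc)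
      then show ?thesis using sh(3)[OF q] by (simp add: nth_append)
    qed
    with l show "coeff_at q y \<in> tlattice (Suc d) [j]" by (simp add: tlattice_def)
  qed
next
  note sh = shape_facts[OF assms(1)]
  assume y: "\<forall>q\<in>Q. coeff_at q y \<in> tlattice (Suc d) [j]"
  have "m \<in> box n (ls @ [j]) \<union> T" if m: "y m \<noteq> 0" for m
  proof (cases "m \<in> T")
    case False
    with m assms(2) have b: "m \<in> box n ls" by (auto simp: supp_space_def)
    with False obtain q m' where q: "q \<in> Q" "m = q @ m'" using sh(5) by blast
    with y m have "j \<le> m' ! 0" by (auto simp: tlattice_def coeff_at_def)
    with b q sh(3) show ?thesis by (simp add: box_snoc nth_append)
  qed simp
  with assms(2) show "y \<in> supp_space n (box n (ls @ [j]) \<union> T)" by (auto simp: supp_space_def)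
qed

lemma tlattice_antimono: "i \<le> j \<Longrightarrow> tlattice n [j] \<subseteq> tlattice n [i]"
  by (force simp: tlattice_def)

lemma filt_antimono:
  "i \<le> j \<Longrightarrow> supp_space n (box n (ls @ [j]) \<union> T) \<subseteq> supp_space n (box n (ls @ [i]) \<union> T)"
  by (intro supp_space_mono) (auto simp: box_snoc)

section \<open>Finite matrices of linear maps between subquotients\<close>

context
  fixes n1 n2 d ls1 ls2 T1 T2 Q1 Q2 and f :: "'k::field iter_series \<Rightarrow> 'k iter_series"
  assumes s1: "block_shape n1 d ls1 T1 Q1" and s2: "block_shape n2 d ls2 T2 Q2"
    and f: "f \<in> hom_quotient smult smult (supp_space n1 (box n1 ls1 \<union> T1)) (supp_space n1 T1)
       (supp_space n2 (box n2 ls2 \<union> T2)) (supp_space n2 T2)"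
begin

lemma
  shows hom_upper: "x \<in> supp_space n1 (box n1 ls1 \<union> T1) \<Longrightarrow> f x \<in> supp_space n2 (box n2 ls2 \<union> T2)"
    and hom_lower: "x \<in> supp_space n1 T1 \<Longrightarrow> f x \<in> supp_space n2 T2"
    and hom_add: "x \<in> supp_space n1 (box n1 ls1 \<union> T1) \<Longrightarrow> y \<in> supp_space n1 (box n1 ls1 \<union> T1) \<Longrightarrow>
       f (x + y) - (f x + f y) \<in> supp_space n2 T2"
    and hom_scale: "x \<in> supp_space n1 (box n1 ls1 \<union> T1) \<Longrightarrow>
       f (smult c x) - smult c (f x) \<in> supp_space n2 T2"
  using f unfolding hom_quotient_def by blast+

text \<open>\<open>f\<close> is additive only modulo the denominator, and
  \<open>coeff_at_lower\<close> kills the error. Thus an honest equality replaces a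
  congruence.\<close>

lemma coeff_hom_add:
  assumes "q \<in> Q2" "x \<in> supp_space n1 (box n1 ls1 \<union> T1)" "y \<in> supp_space n1 (box n1 ls1 \<union> T1)"
  shows "coeff_at q (f (x + y)) = coeff_at q (f x) + coeff_at q (f y)"
proof -
  have "coeff_at q (f (x + y) - (f x + f y)) = 0"
    by (rule coeff_at_lower[OF s2 assms(1) hom_add[OF assms(2,3)]])
  then show ?thesis by simp
qed

lemma coeff_hom_scale:
  assumes "q \<in> Q2" "x \<in> supp_space n1 (box n1 ls1 \<union> T1)"
  shows "coeff_at q (f (smult c x)) = smult c (coeff_at q (f x))"
proof -
  have "coeff_at q (f (smult c x) - smult c (f x)) = 0"
    by (rule coeff_at_lower[OF s2 assms(1) hom_scale[OF assms(2)]])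
  then show ?thesis by simp
qed

lemma coeff_hom_lower: "q \<in> Q2 \<Longrightarrow> x \<in> supp_space n1 T1 \<Longrightarrow> coeff_at q (f x) = 0"
  using coeff_at_lower[OF s2 _ hom_lower] .

lemma coeff_hom_sum:
  assumes "q \<in> Q2" "\<And>i. i \<in> I \<Longrightarrow> x i \<in> supp_space n1 (box n1 ls1 \<union> T1)"
  shows "coeff_at q (f (\<Sum>i\<in>I. x i)) = (\<Sum>i\<in>I. coeff_at q (f (x i)))"
  using assms(2)
proof (induction I rule: infinite_finite_induct)
  case (insert i I)
  then have "x i \<in> supp_space n1 (box n1 ls1 \<union> T1)" "sum x I \<in> supp_space n1 (box n1 ls1 \<union> T1)"
    by (auto intro: fs.subspace_sum[OF supp_space_subspace])
  then show ?case
    using insert by (simp only: sum.insert coeff_hom_add[OF assms(1)] insert_iff simp_thms)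
qed (simp_all only: sum.infinite sum.empty simp_thms coeff_hom_lower[OF assms(1)]
    fs.subspace_0[OF supp_space_subspace])

lemma block_End_k:
  assumes "p \<in> Q1" "q \<in> Q2"
  shows "block f p q \<in> End_k d"
proof -
  note pl = place_upper[OF s1 assms(1)]
  have "block f p q x \<in> laurent d" if "x \<in> laurent d" for x
    unfolding block_def by (rule coeff_at_in_laurent[OF s2 assms(2) hom_upper[OF pl[OF that]]])
  moreover have "block f p q 0 = 0"
    by (simp add: block_def place_linear coeff_hom_lower[OF assms(2)] fs.subspace_0[OF supp_space_subspace])
  moreover have "block f p q (x + y) - (block f p q x + block f p q y) = 0"
    if "x \<in> laurent d" "y \<in> laurent d" for x y
    using coeff_hom_add[OF assms(2) pl[OF that(1)] pl[OF that(2)]] by (simp add: block_def place_linear)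
  moreover have "block f p q (smult c x) - smult c (block f p q x) = 0" if "x \<in> laurent d" for x c
    using coeff_hom_scale[OF assms(2) pl[OF that]] by (simp add: block_def place_linear)
  ultimately show ?thesis unfolding End_k_def hom_quotient_def by auto
qed

text \<open>Finite matrix multiplication: \<open>x\<close> is replaced by the sum of its components,
  and the remainder lies in the denominator, where \<open>f\<close> contributes nothing to the
  coefficient.\<close>

lemma coeff_hom_eq_sum_blocks:
  assumes "q \<in> Q2" "x \<in> supp_space n1 (box n1 ls1 \<union> T1)"
  shows "coeff_at q (f x) = (\<Sum>p\<in>Q1. block f p q (coeff_at p x))"
proof -
  let ?s = "\<Sum>p\<in>Q1. place p (coeff_at p x)"
  have pl: "place p (coeff_at p x) \<in> supp_space n1 (box n1 ls1 \<union> T1)" if "p \<in> Q1" for p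
    by (rule place_upper[OF s1 that coeff_at_in_laurent[OF s1 that assms(2)]])
  have s: "?s \<in> supp_space n1 (box n1 ls1 \<union> T1)"
    by (rule fs.subspace_sum[OF supp_space_subspace pl])
  have w: "x - ?s \<in> supp_space n1 T1" by (rule decomposition[OF s1 assms(2)])
  then have w': "x - ?s \<in> supp_space n1 (box n1 ls1 \<union> T1)"
    using supp_space_mono[of T1 "box n1 ls1 \<union> T1"] by blast
  have "coeff_at q (f x) = coeff_at q (f (?s + (x - ?s)))"
    by (rule arg_cong[of _ _ "\<lambda>z. coeff_at q (f z)"]) (simp only: add_diff_eq add_diff_cancel_left')
  also have "\<dots> = coeff_at q (f ?s)"
    unfolding coeff_hom_add[OF assms(1) s w'] coeff_hom_lower[OF assms(1) w] by simp
  also have "\<dots> = (\<Sum>p\<in>Q1. block f p q (coeff_at p x))"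
    unfolding block_def by (rule coeff_hom_sum[OF assms(1) pl])
  finally show ?thesis .
qed

end

text \<open>One direction tests \<open>f\<close> on series placed in a single summand. The other
  uses the matrix formula and the closure of a lattice under finite sums.\<close>

lemma image_filt_subset_iff:
  fixes f :: "'k::field iter_series \<Rightarrow> 'k iter_series"
  assumes s1: "block_shape n1 (Suc d) ls1 T1 Q1" and s2: "block_shape n2 (Suc d) ls2 T2 Q2"
    and f: "f \<in> hom_quotient smult smult (supp_space n1 (box n1 ls1 \<union> T1)) (supp_space n1 T1)
       (supp_space n2 (box n2 ls2 \<union> T2)) (supp_space n2 T2)"
  shows "f ` supp_space n1 (box n1 (ls1 @ [i]) \<union> T1) \<subseteq> supp_space n2 (box n2 (ls2 @ [j]) \<union> T2) \<longleftrightarrow>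
    (\<forall>p\<in>Q1. \<forall>q\<in>Q2. block f p q ` tlattice (Suc d) [i] \<subseteq> tlattice (Suc d) [j])"
    (is "f ` ?F1 \<subseteq> ?F2 \<longleftrightarrow> ?R")
proof
  have F1: "?F1 \<subseteq> supp_space n1 (box n1 ls1 \<union> T1)"
    by (intro supp_space_mono) (auto simp: box_snoc)
  {
    assume *: "f ` ?F1 \<subseteq> ?F2"
    show ?R
    proof (intro ballI subsetI, elim imageE)
      fix p q x y assume p: "p \<in> Q1" and q: "q \<in> Q2" and x: "x \<in> tlattice (Suc d) [i]"
        and y: "y = block f p q x"
      from x have xl: "x \<in> laurent (Suc d)" by (simp add: tlattice_def)
      have pl: "place p x \<in> supp_space n1 (box n1 ls1 \<union> T1)" by (rule place_upper[OF s1 p xl])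
      \<comment> \<open>The coefficients of the placed series are \<open>x\<close> and zeros, all of
        which lie in the lattice.\<close>
      have "coeff_at p' (place p x) \<in> tlattice (Suc d) [i]" if "p' \<in> Q1" for p'
        using x shape_facts(3)[OF s1 p] shape_facts(3)[OF s1 that]
        by (auto simp: coeff_at_place tlattice_def laurent_zero simp del: laurent.simps)
      then have "place p x \<in> ?F1" by (simp add: tlattice_snoc_iff[OF s1 pl])
      with * have "f (place p x) \<in> ?F2" by blast
      then have "coeff_at q (f (place p x)) \<in> tlattice (Suc d) [j]"
        using tlattice_snoc_iff[OF s2 hom_upper[OF s1 s2 f pl]] q by blast
      then show "y \<in> tlattice (Suc d) [j]" by (simp add: y block_def)
    qed
  }
  {
    assume R: ?R
    show "f ` ?F1 \<subseteq> ?F2"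
    proof
      fix y assume "y \<in> f ` ?F1"
      then obtain x where x: "x \<in> ?F1" and y: "y = f x" by blast
      with F1 have xU: "x \<in> supp_space n1 (box n1 ls1 \<union> T1)" by blast
      have "coeff_at q (f x) \<in> tlattice (Suc d) [j]" if q: "q \<in> Q2" for q
      proof -
        have "block f p q (coeff_at p x) \<in> tlattice (Suc d) [j]" if "p \<in> Q1" for p
          using R q that x tlattice_snoc_iff[OF s1 xU] by blast
        then show ?thesis
          unfolding coeff_hom_eq_sum_blocks[OF s1 s2 f q xU] tlattice_eq
          by (rule fs.subspace_sum[OF supp_space_subspace])
      qed
      then show "y \<in> ?F2" by (simp add: y tlattice_snoc_iff[OF s2 hom_upper[OF s1 s2 f xU]])
    qed
  }
qed

text \<open>The induced map is the same function; enlarging the target denominator only weakens the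
  linearity conditions.\<close>

lemma hom_quotient_restrict:
  assumes "f \<in> hom_quotient s1 s2 U1 W1 U2 W2" "U1' \<subseteq> U1" "f ` U1' \<subseteq> U2'" "f ` W1' \<subseteq> W2'"
    "W2 \<subseteq> W2'"
  shows "f \<in> hom_quotient s1 s2 U1' W1' U2' W2'"
proof -
  have "f (x + y) - (f x + f y) \<in> W2'" if "x \<in> U1'" "y \<in> U1'" for x y
    using assms(1,2,5) that unfolding hom_quotient_def by blast
  moreover have "f (s1 c x) - s2 c (f x) \<in> W2'" if "x \<in> U1'" for x c
    using assms(1,2,5) that unfolding hom_quotient_def by blast
  ultimately show ?thesis using assms(3,4) unfolding hom_quotient_def by blast
qed

section \<open>Morphisms and their blocks\<close>

text \<open>The induction claim for one map. It ranges over all shapes of source and target because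
  condition (3) involves arbitrary pairs of windows.\<close>

definition cn_mor_blockwise :: "nat \<Rightarrow> ('k::field iter_series \<Rightarrow> 'k iter_series) \<Rightarrow> bool" where
  "cn_mor_blockwise d f \<longleftrightarrow> (\<forall>n1 n2 ls1 ls2 T1 T2 Q1 Q2.
      block_shape n1 d ls1 T1 Q1 \<longrightarrow> block_shape n2 d ls2 T2 Q2 \<longrightarrow>
      (f \<in> cn_mor smult smult d (std_block n1 d ls1 T1) (std_block n2 d ls2 T2) \<longleftrightarrow>
       f \<in> hom_quotient smult smult (supp_space n1 (box n1 ls1 \<union> T1)) (supp_space n1 T1)
         (supp_space n2 (box n2 ls2 \<union> T2)) (supp_space n2 T2) \<and>
       (\<forall>p\<in>Q1. \<forall>q\<in>Q2. block f p q \<in> End_C d)))"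

text \<open>Eliminates the windows of condition (3): every pair of exponents \<open>a\<close>,
  \<open>b\<close> occurs in some admissible pair of windows, and the blocks do not depend on the
  windows.\<close>

lemma cn_mor_std_block_step:
  fixes f :: "'k::field iter_series \<Rightarrow> 'k iter_series"
  assumes IH: "cn_mor_blockwise d f"
    and s1: "block_shape n1 (Suc d) ls1 T1 Q1" and s2: "block_shape n2 (Suc d) ls2 T2 Q2"
  shows "f \<in> cn_mor smult smult (Suc d) (std_block n1 (Suc d) ls1 T1) (std_block n2 (Suc d) ls2 T2) \<longleftrightarrow>
      f \<in> hom_quotient smult smult (supp_space n1 (box n1 ls1 \<union> T1)) (supp_space n1 T1)
         (supp_space n2 (box n2 ls2 \<union> T2)) (supp_space n2 T2) \<and>
      (\<forall>i. \<exists>j. \<forall>p\<in>Q1. \<forall>q\<in>Q2. block f p q ` tlattice (Suc d) [i] \<subseteq> tlattice (Suc d) [j]) \<and>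
      (\<forall>j. \<exists>i. \<forall>p\<in>Q1. \<forall>q\<in>Q2. block f p q ` tlattice (Suc d) [i] \<subseteq> tlattice (Suc d) [j]) \<and>
      (\<forall>p\<in>Q1. \<forall>q\<in>Q2. \<forall>a b. block f (p @ [a]) (q @ [b]) \<in> End_C d)"
    (is "_ \<longleftrightarrow> ?H \<and> _")
proof (cases ?H)
  case False
  then show ?thesis
    by (simp only: cn_mor.simps mem_Collect_eq std_block_sel simp_thms)
next
  case H: True
  let ?F1 = "\<lambda>i. supp_space n1 (box n1 (ls1 @ [i]) \<union> T1) :: 'k iter_series set"
  let ?F2 = "\<lambda>i. supp_space n2 (box n2 (ls2 @ [i]) \<union> T2) :: 'k iter_series set"
  let ?M = "\<lambda>i1 i2 j1 j2. f \<in> cn_mor smult smult d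
      (std_block n1 d (ls1 @ [i2]) (box n1 (ls1 @ [i1]) \<union> T1))
      (std_block n2 d (ls2 @ [j2]) (box n2 (ls2 @ [j1]) \<union> T2))"
  \<comment> \<open>The induction hypothesis for one pair of windows, whose summands are indexed by
    the old prefixes extended by an exponent of the window.\<close>
  have M: "?M i1 i2 j1 j2 \<longleftrightarrow> (\<forall>p\<in>Q1. \<forall>q\<in>Q2. \<forall>a\<in>{i2..<i1}. \<forall>b\<in>{j2..<j1}.
      block f (p @ [a]) (q @ [b]) \<in> End_C d)"
    if "i2 \<le> i1" "j2 \<le> j1" "f ` ?F1 i1 \<subseteq> ?F2 j1" "f ` ?F1 i2 \<subseteq> ?F2 j2" for i1 i2 j1 j2
  proof -
    have "?F1 i2 \<subseteq> supp_space n1 (box n1 ls1 \<union> T1)"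
      by (rule supp_space_mono) (auto simp: box_snoc)
    moreover have "supp_space n2 T2 \<subseteq> ?F2 j1"
      by (rule supp_space_mono) blast
    ultimately have "f \<in> hom_quotient smult smult (?F1 i2) (?F1 i1) (?F2 j2) (?F2 j1)"
      using hom_quotient_restrict[OF H _ that(4,3)] by blast
    moreover have "box n1 (ls1 @ [i2]) \<union> (box n1 (ls1 @ [i1]) \<union> T1) = box n1 (ls1 @ [i2]) \<union> T1"
      "box n2 (ls2 @ [j2]) \<union> (box n2 (ls2 @ [j1]) \<union> T2) = box n2 (ls2 @ [j2]) \<union> T2"
      using that(1,2) by (auto simp: box_snoc)
    ultimately have "?M i1 i2 j1 j2 \<longleftrightarrow> (\<forall>p\<in>(\<lambda>(q, a). q @ [a]) ` (Q1 \<times> {i2..<i1}).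
        \<forall>q\<in>(\<lambda>(q, a). q @ [a]) ` (Q2 \<times> {j2..<j1}). block f p q \<in> End_C d)"
      using IH[unfolded cn_mor_blockwise_def, rule_format,
          OF block_shape_quot[OF s1 that(1)] block_shape_quot[OF s2 that(2)]]
      by (simp only: simp_thms)
    then show ?thesis by fastforce
  qed
  \<comment> \<open>\<open>quot_std_block\<close> needs the order of the indices, so the rewriting
    takes place under the premises of condition (3).\<close>
  have quot_eq: "(i2 \<le> i1 \<and> j2 \<le> j1 \<and> P \<longrightarrow> f \<in> cn_mor smult smult d
      (quot (std_block n1 (Suc d) ls1 T1) i1 i2) (quot (std_block n2 (Suc d) ls2 T2) j1 j2)) \<longleftrightarrow>
      (i2 \<le> i1 \<and> j2 \<le> j1 \<and> P \<longrightarrow> ?M i1 i2 j1 j2)" for i1 i2 j1 j2 P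
    using quot_std_block by metis
  have "f \<in> cn_mor smult smult (Suc d) (std_block n1 (Suc d) ls1 T1) (std_block n2 (Suc d) ls2 T2) \<longleftrightarrow>
      (\<forall>i. \<exists>j. f ` ?F1 i \<subseteq> ?F2 j) \<and> (\<forall>j. \<exists>i. f ` ?F1 i \<subseteq> ?F2 j) \<and>
      (\<forall>i1 i2 j1 j2. i2 \<le> i1 \<and> j2 \<le> j1 \<and> f ` ?F1 i1 \<subseteq> ?F2 j1 \<and> f ` ?F1 i2 \<subseteq> ?F2 j2 \<longrightarrow>
        ?M i1 i2 j1 j2)"
    unfolding cn_mor.simps mem_Collect_eq std_block_sel std_block_Suc_sel ball_UNIV bex_UNIV case_prod_conv
    by (simp only: H quot_eq simp_thms)
  also have "\<dots> \<longleftrightarrow> (\<forall>i. \<exists>j. f ` ?F1 i \<subseteq> ?F2 j) \<and> (\<forall>j. \<exists>i. f ` ?F1 i \<subseteq> ?F2 j) \<and>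
      (\<forall>p\<in>Q1. \<forall>q\<in>Q2. \<forall>a b. block f (p @ [a]) (q @ [b]) \<in> End_C d)"
  proof (intro conj_cong refl iffI)
    assume 1: "\<forall>i. \<exists>j. f ` ?F1 i \<subseteq> ?F2 j" and 2: "\<forall>j. \<exists>i. f ` ?F1 i \<subseteq> ?F2 j"
      and 3: "\<forall>i1 i2 j1 j2. i2 \<le> i1 \<and> j2 \<le> j1 \<and> f ` ?F1 i1 \<subseteq> ?F2 j1 \<and> f ` ?F1 i2 \<subseteq> ?F2 j2 \<longrightarrow>
        ?M i1 i2 j1 j2"
    show "\<forall>p\<in>Q1. \<forall>q\<in>Q2. \<forall>a b. block f (p @ [a]) (q @ [b]) \<in> End_C d"
    proof (intro ballI allI)
      fix p q a b assume pq: "p \<in> Q1" "q \<in> Q2"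
      \<comment> \<open>Condition (2) at \<open>b + 1\<close> bounds the small ends of the windows
        and condition (1) at \<open>a\<close> the large ends. Raising \<open>i\<close> above
        \<open>a\<close> and lowering \<open>j\<close> to at most \<open>b\<close> puts
        \<open>a\<close> and \<open>b\<close> inside the half-open windows.\<close>
      obtain i where i: "f ` ?F1 i \<subseteq> ?F2 (b + 1)" using 2 by blast
      obtain j where j: "f ` ?F1 a \<subseteq> ?F2 j" using 1 by blast
      have i': "f ` ?F1 (max i (a + 1)) \<subseteq> ?F2 (b + 1)"
        by (rule subset_trans[OF image_mono[OF filt_antimono] i]) simp
      have j': "f ` ?F1 a \<subseteq> ?F2 (min j b)"
        by (rule subset_trans[OF j filt_antimono]) simp
      have le: "a \<le> max i (a + 1)" "min j b \<le> b + 1" by simp_all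
      have "?M (max i (a + 1)) a (b + 1) (min j b)" using 3 le i' j' by blast
      moreover have "a \<in> {a..<max i (a + 1)}" "b \<in> {min j b..<b + 1}" by auto
      ultimately show "block f (p @ [a]) (q @ [b]) \<in> End_C d"
        using pq unfolding M[OF le i' j'] by blast
    qed
  next
    assume 3: "\<forall>p\<in>Q1. \<forall>q\<in>Q2. \<forall>a b. block f (p @ [a]) (q @ [b]) \<in> End_C d"
    show "\<forall>i1 i2 j1 j2. i2 \<le> i1 \<and> j2 \<le> j1 \<and> f ` ?F1 i1 \<subseteq> ?F2 j1 \<and> f ` ?F1 i2 \<subseteq> ?F2 j2 \<longrightarrow>
        ?M i1 i2 j1 j2"
    proof (intro allI impI, elim conjE)
      fix i1 i2 j1 j2
      assume *: "i2 \<le> i1" "j2 \<le> j1" "f ` ?F1 i1 \<subseteq> ?F2 j1" "f ` ?F1 i2 \<subseteq> ?F2 j2"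
      show "?M i1 i2 j1 j2" unfolding M[OF *] using 3 by blast
    qed
  qed
  finally show ?thesis
    using H by (simp only: image_filt_subset_iff[OF s1 s2 H] simp_thms)
qed

text \<open>The minimum of finitely many bounds works for all of them. This turns conditions (1) and
  (2) for a map into conditions on each block separately.\<close>

lemma uniform_lower_bound:
  fixes R :: "'a \<Rightarrow> int \<Rightarrow> bool"
  assumes "finite Q" "\<And>p i j. R p j \<Longrightarrow> i \<le> j \<Longrightarrow> R p i"
  shows "(\<exists>j. \<forall>p\<in>Q. R p j) \<longleftrightarrow> (\<forall>p\<in>Q. \<exists>j. R p j)"
  using assms(1)
proof (induction Q)
  case (insert p Q)
  have "\<exists>j. R p j \<and> (\<forall>p\<in>Q. R p j)" if "R p i" "\<forall>p\<in>Q. R p j" for i j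
    using that assms(2) by (intro exI[of _ "min i j"]) (meson min.cobounded1 min.cobounded2)
  with insert show ?case by auto
qed simp

text \<open>Obtained from the previous lemma by the reflection of \<open>j\<close> to
  \<open>- j\<close>.\<close>

lemma uniform_upper_bound:
  fixes R :: "'a \<Rightarrow> int \<Rightarrow> bool"
  assumes "finite Q" "\<And>p i j. R p i \<Longrightarrow> i \<le> j \<Longrightarrow> R p j"
  shows "(\<exists>j. \<forall>p\<in>Q. R p j) \<longleftrightarrow> (\<forall>p\<in>Q. \<exists>j. R p j)"
proof -
  have "(\<exists>j. \<forall>p\<in>Q. R p (- j)) \<longleftrightarrow> (\<forall>p\<in>Q. \<exists>j. R p (- j))"
    by (rule uniform_lower_bound[OF assms(1)]) (use assms(2) in force)
  then show ?thesis by (metis minus_minus)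
qed

lemma block_Nil: "block f [] [] = f"
  by (simp add: block_def fun_eq_iff)

text \<open>The whole space is the shape with the single summand \<open>[]\<close>. The blockwise
  claim is a premise because this equivalence is also applied to the blocks within the
  induction.\<close>

lemma End_C_Suc_step:
  fixes f :: "'k::field iter_series \<Rightarrow> 'k iter_series"
  assumes "cn_mor_blockwise d f"
  shows "f \<in> End_C (Suc d) \<longleftrightarrow> f \<in> End_k (Suc d) \<and>
      (\<forall>i. \<exists>j. f ` tlattice (Suc d) [i] \<subseteq> tlattice (Suc d) [j]) \<and>
      (\<forall>j. \<exists>i. f ` tlattice (Suc d) [i] \<subseteq> tlattice (Suc d) [j]) \<and>
      (\<forall>a b. block f [a] [b] \<in> End_C d)"
  unfolding End_C_def[of "Suc d"] std_laurent_eq[of "Suc d"]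
    cn_mor_std_block_step[OF assms block_shape_whole block_shape_whole]
  by (simp only: supp_space_whole End_k_def[symmetric] block_Nil append_Nil ball_simps simp_thms)

text \<open>Expanding one level for \<open>f\<close> and for each block gives the same conditions up
  to the order of quantifiers; \<open>block_append\<close> matches the next-level blocks.\<close>

lemma cn_mor_blockwise: "cn_mor_blockwise d f"
proof (induction d arbitrary: f)
  case 0
  \<comment> \<open>At level 0 morphisms are just linear maps, so only linearity of the blocks is at
    stake.\<close>
  have "block f p q \<in> End_C 0" if "block_shape n1 0 ls1 T1 Q1" "block_shape n2 0 ls2 T2 Q2"
      "f \<in> hom_quotient smult smult
      (supp_space n1 (box n1 ls1 \<union> T1)) (supp_space n1 T1)
      (supp_space n2 (box n2 ls2 \<union> T2)) (supp_space n2 T2)" "p \<in> Q1" "q \<in> Q2"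
    for n1 n2 ls1 ls2 T1 T2 Q1 Q2 p q
    using block_End_k[OF that] by (simp add: End_k_def End_C_def std_laurent_def)
  then show ?case unfolding cn_mor_blockwise_def cn_mor.simps std_block_sel by blast
next
  case (Suc d)
  show ?case
    unfolding cn_mor_blockwise_def
  proof (intro allI impI)
    fix n1 n2 ls1 ls2 T1 T2 Q1 Q2
    assume s1: "block_shape n1 (Suc d) ls1 T1 Q1" and s2: "block_shape n2 (Suc d) ls2 T2 Q2"
    let ?H = "f \<in> hom_quotient smult smult
        (supp_space n1 (box n1 ls1 \<union> T1)) (supp_space n1 T1)
        (supp_space n2 (box n2 ls2 \<union> T2)) (supp_space n2 T2)"
    \<comment> \<open>Pairs of summands form one finite index set, so each exchange of quantifiers
      is a single application.\<close>
    define R where "R pq i j \<longleftrightarrow>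
        block f (fst pq) (snd pq) ` tlattice (Suc d) [i] \<subseteq> tlattice (Suc d) [j]" for pq i j
    have R_mono: "R pq i' j'" if "R pq i j" "i \<le> i'" "j' \<le> j" for pq i i' j j'
      using that(1) tlattice_antimono[OF that(2)] tlattice_antimono[OF that(3)]
      unfolding R_def by blast
    have fin: "finite (Q1 \<times> Q2)" using shape_facts(2)[OF s1] shape_facts(2)[OF s2] by blast
    have lower: "(\<exists>j. \<forall>p\<in>Q1. \<forall>q\<in>Q2. R (p, q) i j) \<longleftrightarrow> (\<forall>p\<in>Q1. \<forall>q\<in>Q2. \<exists>j. R (p, q) i j)" for i
    proof -
      have "(\<exists>j. \<forall>pq\<in>Q1 \<times> Q2. R pq i j) \<longleftrightarrow> (\<forall>pq\<in>Q1 \<times> Q2. \<exists>j. R pq i j)"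
        by (rule uniform_lower_bound[OF fin]) (rule R_mono[OF _ order_refl])
      then show ?thesis by (simp only: split_paired_Ball_Sigma)
    qed
    have upper: "(\<exists>i. \<forall>p\<in>Q1. \<forall>q\<in>Q2. R (p, q) i j) \<longleftrightarrow> (\<forall>p\<in>Q1. \<forall>q\<in>Q2. \<exists>i. R (p, q) i j)" for j
    proof -
      have "(\<exists>i. \<forall>pq\<in>Q1 \<times> Q2. R pq i j) \<longleftrightarrow> (\<forall>pq\<in>Q1 \<times> Q2. \<exists>i. R pq i j)"
        by (rule uniform_upper_bound[OF fin]) (rule R_mono[OF _ _ order_refl])
      then show ?thesis by (simp only: split_paired_Ball_Sigma)
    qed
    show "f \<in> cn_mor smult smult (Suc d) (std_block n1 (Suc d) ls1 T1) (std_block n2 (Suc d) ls2 T2) \<longleftrightarrow>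
        ?H \<and> (\<forall>p\<in>Q1. \<forall>q\<in>Q2. block f p q \<in> End_C (Suc d))"
    proof (cases ?H)
      case True
      have "block f p q \<in> End_C (Suc d) \<longleftrightarrow>
          (\<forall>i. \<exists>j. R (p, q) i j) \<and> (\<forall>j. \<exists>i. R (p, q) i j) \<and>
          (\<forall>a b. block f (p @ [a]) (q @ [b]) \<in> End_C d)" if "p \<in> Q1" "q \<in> Q2" for p q
        using block_End_k[OF s1 s2 True that]
        by (simp only: End_C_Suc_step[OF Suc.IH] block_append R_def fst_conv snd_conv simp_thms)
      then have "(\<forall>p\<in>Q1. \<forall>q\<in>Q2. block f p q \<in> End_C (Suc d)) \<longleftrightarrow>
          (\<forall>p\<in>Q1. \<forall>q\<in>Q2. (\<forall>i. \<exists>j. R (p, q) i j) \<and> (\<forall>j. \<exists>i. R (p, q) i j) \<and>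
             (\<forall>a b. block f (p @ [a]) (q @ [b]) \<in> End_C d))"
        by (intro ball_cong refl)
      also have "\<dots> \<longleftrightarrow> (\<forall>i. \<exists>j. \<forall>p\<in>Q1. \<forall>q\<in>Q2. R (p, q) i j) \<and>
          (\<forall>j. \<exists>i. \<forall>p\<in>Q1. \<forall>q\<in>Q2. R (p, q) i j) \<and>
          (\<forall>p\<in>Q1. \<forall>q\<in>Q2. \<forall>a b. block f (p @ [a]) (q @ [b]) \<in> End_C d)"
        unfolding lower upper by (intro iffI conjI allI ballI) blast+
      finally show ?thesis
        by (simp only: cn_mor_std_block_step[OF Suc.IH s1 s2] True R_def fst_conv snd_conv simp_thms)
    qed (simp only: cn_mor_std_block_step[OF Suc.IH s1 s2] simp_thms)
  qed
qed

section \<open>The matrix over \<open>k((t\<^sub>n))\<dots>((t\<^sub>2))\<close>\<close>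

lemmas End_C_Suc_iff = End_C_Suc_step[OF cn_mor_blockwise, unfolded block_singleton]

lemma tlattice_singleton_iff:
  "f \<in> tlattice (Suc n) [i] \<longleftrightarrow> f \<in> laurent (Suc n) \<and> (\<forall>j<i. coeff1 f j = 0)"
proof (cases "f \<in> laurent (Suc n)")
  case True
  have "(\<forall>m. f m \<noteq> 0 \<longrightarrow> i \<le> m ! 0) \<longleftrightarrow> (\<forall>j m. f (j # m) \<noteq> 0 \<longrightarrow> i \<le> j)"
  proof
    assume *: "\<forall>j m. f (j # m) \<noteq> 0 \<longrightarrow> i \<le> j"
    show "\<forall>m. f m \<noteq> 0 \<longrightarrow> i \<le> m ! 0"
    proof (intro allI impI)
      fix m assume m: "f m \<noteq> 0"
      with True obtain j m' where "m = j # m'" by (cases m) auto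
      with * m show "i \<le> m ! 0" by auto
    qed
  qed force
  also have "\<dots> \<longleftrightarrow> (\<forall>j<i. coeff1 f j = 0)"
    by (auto simp: coeff1_def fun_eq_iff not_le[symmetric])
  finally show ?thesis by (simp add: tlattice_def)
qed (simp add: tlattice_def del: laurent.simps)

lemma tlattice_times_t1_power:
  "x \<in> laurent n \<Longrightarrow> i \<le> j \<Longrightarrow> times_t1_power x j \<in> tlattice (Suc n) [i]"
  by (simp add: tlattice_singleton_iff laurent_times_t1_power coeff1_times_t1_power
      del: laurent.simps)

lemma block_shape_step:
  "i \<le> j \<Longrightarrow> block_shape (Suc n) n [i] (box (Suc n) [j]) ((\<lambda>a. [a]) ` {i..<j})"
proof -
  assume "i \<le> j"
  moreover have "(\<lambda>(q, a). q @ [a]) ` ({[]} \<times> {i..<j}) = (\<lambda>a. [a]) ` {i..<j}" by force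
  ultimately show ?thesis using block_shape_quot[OF block_shape_whole[of "Suc n"]] by fastforce
qed

text \<open>\<open>A\<close> induces a map between the quotients with exponent windows
  \<open>{M..<N}\<close> and \<open>{J..<j + 1}\<close>, where the finite matrix formula applies.
  The upper end \<open>j + 1\<close> keeps the exponent \<open>j\<close> in the target
  window.\<close>

lemma coeff1_End_k_eq_sum:
  fixes A :: "'k::field iter_series \<Rightarrow> 'k iter_series"
  assumes A: "A \<in> End_k (Suc n)" and upper: "A ` tlattice (Suc n) [M] \<subseteq> tlattice (Suc n) [J]"
    and lower: "A ` tlattice (Suc n) [N] \<subseteq> tlattice (Suc n) [j + 1]"
    and le: "M \<le> N" "J \<le> j" and f: "f \<in> tlattice (Suc n) [M]"
  shows "coeff1 (A f) j = (\<Sum>i\<in>{M..<N}. matrix_entry A i j (coeff1 f i))"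
proof -
  have U: "supp_space (Suc n) (box (Suc n) [k] \<union> box (Suc n) [l]) = (tlattice (Suc n) [k] :: 'k iter_series set)"
    if "k \<le> l" for k l
  proof -
    have "box (Suc n) [k] \<union> box (Suc n) [l] = box (Suc n) [k]"
      using that box_snoc[of "Suc n" "[]"] by auto
    then show ?thesis by (simp add: tlattice_eq)
  qed
  have "tlattice (Suc n) [M] \<subseteq> (laurent (Suc n) :: 'k iter_series set)"
    "{0} \<subseteq> (tlattice (Suc n) [j + 1] :: 'k iter_series set)"
    by (auto simp: tlattice_def laurent_zero simp del: laurent.simps)
  then have "A \<in> hom_quotient smult smult (tlattice (Suc n) [M]) (tlattice (Suc n) [N])
      (tlattice (Suc n) [J]) (tlattice (Suc n) [j + 1])"
    using hom_quotient_restrict[OF A[unfolded End_k_def] _ upper lower] by blast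
  then have hom: "A \<in> hom_quotient smult smult
      (supp_space (Suc n) (box (Suc n) [M] \<union> box (Suc n) [N])) (supp_space (Suc n) (box (Suc n) [N]))
      (supp_space (Suc n) (box (Suc n) [J] \<union> box (Suc n) [j + 1])) (supp_space (Suc n) (box (Suc n) [j + 1]))"
    using le by (simp only: U tlattice_eq[symmetric] zle_add1_eq_le add_increasing2 zero_le_one)
  have J: "J \<le> j + 1" using le by simp
  have "[j] \<in> (\<lambda>a. [a]) ` {J..<j + 1}" using le by simp
  moreover have "f \<in> supp_space (Suc n) (box (Suc n) [M] \<union> box (Suc n) [N])"
    using f U[OF le(1)] by blast
  ultimately have "coeff_at [j] (A f) = (\<Sum>p\<in>(\<lambda>a. [a]) ` {M..<N}. block A p [j] (coeff_at p f))"
    by (rule coeff_hom_eq_sum_blocks[OF block_shape_step[OF le(1)] block_shape_step[OF J] hom])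
  also have "\<dots> = (\<Sum>i\<in>{M..<N}. block A [i] [j] (coeff_at [i] f))"
    by (subst sum.reindex) (auto simp: inj_on_def)
  finally show ?thesis by (simp only: block_singleton coeff_at_Cons coeff_at_Nil)
qed

text \<open>The exponent \<open>a i\<close> is the largest \<open>j \<le> i\<close> with \<open>R i j\<close>; without the bound \<open>j \<le> i\<close> there may be
  no largest one.\<close>

lemma ex_mono_exponents:
  fixes R :: "int \<Rightarrow> int \<Rightarrow> bool"
  assumes anti: "\<And>i j i' j'. R i j \<Longrightarrow> i \<le> i' \<Longrightarrow> j' \<le> j \<Longrightarrow> R i' j'"
    and 1: "\<forall>i. \<exists>j. R i j" and 2: "\<forall>j. \<exists>i. R i j"
  shows "\<exists>a. mono a \<and> filterlim a at_top at_top \<and> (\<forall>i. R i (a i))"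
proof -
  have "\<exists>m. m \<le> i \<and> R i m \<and> (\<forall>l\<le>i. R i l \<longrightarrow> l \<le> m)" for i
  proof -
    from 1 obtain j where "R i j" by blast
    then have "R i (min i j)" using anti[of i j i "min i j"] by simp
    \<comment> \<open>A finite nonempty set of candidates, so that a maximum exists; candidates
      below \<open>min i j\<close> cannot exceed it.\<close>
    define S where "S = {l \<in> {min i j..i}. R i l}"
    have fin: "finite S" unfolding S_def by (rule finite_subset[of _ "{min i j..i}"]) auto
    have min: "min i j \<in> S" using \<open>R i (min i j)\<close> by (simp add: S_def)
    then have "Max S \<in> S" using Max_in[OF fin] by blast
    moreover have "l \<le> Max S" if "l \<le> i" "R i l" for l
    proof (cases "min i j \<le> l")
      case True
      with that show ?thesis by (intro Max_ge[OF fin]) (simp add: S_def)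
    next
      case False
      with Max_ge[OF fin min] show ?thesis by simp
    qed
    ultimately show ?thesis by (intro exI[of _ "Max S"]) (auto simp: S_def)
  qed
  then obtain a where a: "\<And>i. a i \<le> i" "\<And>i. R i (a i)" and max: "\<And>i j. j \<le> i \<Longrightarrow> R i j \<Longrightarrow> j \<le> a i"
    by metis
  have "mono a"
  proof (rule monoI)
    fix i i' :: int assume le: "i \<le> i'"
    show "a i \<le> a i'"
      using max[of "a i" i'] anti[OF a(2) le order_refl] a(1)[of i] le by simp
  qed
  moreover have "filterlim a at_top at_top"
    unfolding filterlim_at_top eventually_at_top_linorder
  proof
    fix j
    from 2 obtain i where i: "R i j" by blast
    \<comment> \<open>\<open>i'\<close> must be at least \<open>i\<close> for \<open>R i' j\<close>,
      and at least \<open>j\<close> because only exponents up to \<open>i'\<close> compete for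
      \<open>a i'\<close>.\<close>
    have "j \<le> a i'" if "max i j \<le> i'" for i'
      using max[of j i'] anti[OF i, of i' j] that by simp
    then show "\<exists>N. \<forall>i\<ge>N. j \<le> a i" by blast
  qed
  ultimately show ?thesis using a(2) by blast
qed

text \<open>The conjunct \<open>acts_by_matrix n A\<close> cannot be dropped:
  \<open>matrix_does_not_determine\<close> gives a map outside \<open>End_C 1\<close> whose matrix
  vanishes.\<close>

theorem proposition2:
  fixes A :: "'k::field iter_series \<Rightarrow> 'k iter_series" and n :: nat
  assumes "n \<ge> 1" and "A \<in> End_k n"
  shows "A \<in> End_C n \<longleftrightarrow>
    acts_by_matrix n A \<and>
    (\<exists>a :: int \<Rightarrow> int. mono a \<and> filterlim a at_top at_top \<and>
       (\<forall>i j. j < a i \<longrightarrow> (\<forall>x\<in>laurent (n - 1). matrix_entry A i j x = 0))) \<and>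
    (\<forall>i j. matrix_entry A i j \<in> End_C (n - 1))"
proof -
  from assms(1) obtain p where n: "n = Suc p" by (cases n) auto
  define R where "R i j \<longleftrightarrow> A ` tlattice n [i] \<subseteq> tlattice n [j]" for i j
  have RD: "A f \<in> tlattice n [j]" if "R i j" "f \<in> tlattice n [i]" for i j f
    using that unfolding R_def by blast
  have R_anti: "R i' j'" if "R i j" "i \<le> i'" "j' \<le> j" for i j i' j'
    using that(1) tlattice_antimono[OF that(2), of n] tlattice_antimono[OF that(3), of n]
    unfolding R_def by blast
  have A: "A \<in> End_k (Suc p)" using assms(2) n by simp
  have A0: "A 0 = 0" using A by (auto simp: End_k_def hom_quotient_def)
  have A_laurent: "A f \<in> laurent n" if "f \<in> laurent n" for f
    using assms(2) that by (auto simp: End_k_def hom_quotient_def)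
  have coeff1_laurent: "coeff1 f i \<in> laurent p" if "f \<in> laurent n" for f :: "'k iter_series" and i
    using that unfolding n by simp
  have entry_0: "matrix_entry A i j 0 = 0" for i j
  proof -
    have "times_t1_power 0 i = (0 :: 'k iter_series)"
      by (auto simp: times_t1_power_def fun_eq_iff split: list.splits)
    then show ?thesis by (simp add: matrix_entry_def A0)
  qed
  have entry_zero: "matrix_entry A i j x = 0"
    if "R i' j'" "i' \<le> i" "j < j'" "x \<in> laurent p" for i i' j j' x
  proof -
    have "times_t1_power x i \<in> tlattice n [i']" unfolding n by (rule tlattice_times_t1_power[OF that(4,2)])
    with that(1) have "A (times_t1_power x i) \<in> tlattice n [j']" by (rule RD)
    with that(3) show ?thesis unfolding n tlattice_singleton_iff matrix_entry_def by blast
  qed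
  have bounded_acts: "acts_by_matrix n A"
    if 1: "\<forall>i. \<exists>j. R i j" and 2: "\<forall>j. \<exists>i. R i j"
    unfolding acts_by_matrix_def
  proof (intro ballI allI)
    fix f :: "'k iter_series" and j assume f: "f \<in> laurent n"
    then obtain M where M: "\<forall>i<M. coeff1 f i = 0" unfolding n by auto
    \<comment> \<open>With \<open>j + 1\<close>, terms of \<open>f\<close> from \<open>N\<close> on
      contribute nothing to the coefficient at \<open>j\<close>. The maximum and minimum below
      secure the order conditions on the two windows.\<close>
    from 2 obtain N where "R N (j + 1)" by blast
    then have N: "R (max M N) (j + 1)" by (rule R_anti) simp_all
    from 1 obtain J where "R M J" by blast
    then have J: "R M (min J j)" by (rule R_anti) simp_all
    have "f \<in> tlattice n [M]" using f M unfolding n tlattice_singleton_iff by blast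
    then have "coeff1 (A f) j = (\<Sum>i\<in>{M..<max M N}. matrix_entry A i j (coeff1 f i))"
      using coeff1_End_k_eq_sum[OF A J[unfolded R_def n] N[unfolded R_def n] max.cobounded1 min.cobounded2]
      unfolding n by blast
    moreover have "matrix_entry A i j (coeff1 f i) = 0" if "i \<notin> {M..<max M N}" for i
    proof (cases "i < M")
      case True
      with M show ?thesis by (simp add: entry_0)
    next
      case False
      with that have "max M N \<le> i" by simp
      then show ?thesis by (rule entry_zero[OF N]) (simp_all add: coeff1_laurent[OF f])
    qed
    then have sub: "{i. matrix_entry A i j (coeff1 f i) \<noteq> 0} \<subseteq> {M..<max M N}" by blast
    have "(\<Sum>i\<in>{M..<max M N}. matrix_entry A i j (coeff1 f i)) =
        (\<Sum>i | matrix_entry A i j (coeff1 f i) \<noteq> 0. matrix_entry A i j (coeff1 f i))"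
      by (rule sum.mono_neutral_right[OF _ sub]) auto
    ultimately show "finite {i. matrix_entry A i j (coeff1 f i) \<noteq> 0} \<and>
        coeff1 (A f) j = (\<Sum>i | matrix_entry A i j (coeff1 f i) \<noteq> 0. matrix_entry A i j (coeff1 f i))"
      using finite_subset[OF sub] by simp
  qed
  have boundedI: "R i (a i)"
    if acts: "acts_by_matrix n A" and a: "mono a"
      "\<forall>i j. j < a i \<longrightarrow> (\<forall>x\<in>laurent p. matrix_entry A i j x = 0)" for a :: "int \<Rightarrow> int" and i
    unfolding R_def
  proof
    fix g assume "g \<in> A ` tlattice n [i]"
    then obtain f where f: "f \<in> tlattice n [i]" and g: "g = A f" by blast
    from f have fl: "f \<in> laurent n" and f0: "\<And>k. k < i \<Longrightarrow> coeff1 f k = 0"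
      unfolding n tlattice_singleton_iff by blast+
    have "coeff1 (A f) j = 0" if j: "j < a i" for j
    proof -
      \<comment> \<open>For \<open>k < i\<close> the input coefficient is zero; for
        \<open>k \<ge> i\<close> monotonicity of \<open>a\<close> makes the entry vanish. Only
        \<open>acts_by_matrix\<close> then transfers this to \<open>A f\<close>.\<close>
      have "matrix_entry A k j (coeff1 f k) = 0" for k
      proof (cases "k < i")
        case True
        then show ?thesis by (simp add: f0 entry_0)
      next
        case False
        then have "j < a k" using j monoD[OF a(1), of i k] by simp
        with a(2) coeff1_laurent[OF fl] show ?thesis by blast
      qed
      then show ?thesis using acts fl unfolding acts_by_matrix_def by simp
    qed
    then show "g \<in> tlattice n [a i]"
      using A_laurent[OF fl] unfolding g n tlattice_singleton_iff by blast
  qed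
  have "(\<forall>i. \<exists>j. R i j) \<and> (\<forall>j. \<exists>i. R i j) \<longleftrightarrow>
      acts_by_matrix n A \<and> (\<exists>a :: int \<Rightarrow> int. mono a \<and> filterlim a at_top at_top \<and>
       (\<forall>i j. j < a i \<longrightarrow> (\<forall>x\<in>laurent p. matrix_entry A i j x = 0)))" (is "?B \<longleftrightarrow> ?M")
  proof
    assume B: ?B
    have "\<exists>a. mono a \<and> filterlim a at_top at_top \<and> (\<forall>i. R i (a i))"
      using B by (elim conjE) (rule ex_mono_exponents, rule R_anti)
    then obtain a where a: "mono a" "filterlim a at_top at_top" "\<And>i. R i (a i)" by blast
    have "\<forall>i j. j < a i \<longrightarrow> (\<forall>x\<in>laurent p. matrix_entry A i j x = 0)"
      using entry_zero[OF a(3) order_refl] by blast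
    with a B bounded_acts show ?M by blast
  next
    assume ?M
    then obtain a :: "int \<Rightarrow> int" where acts: "acts_by_matrix n A" and a: "mono a"
        "\<forall>i j. j < a i \<longrightarrow> (\<forall>x\<in>laurent p. matrix_entry A i j x = 0)"
      and lim: "filterlim a at_top at_top" by blast
    note R = boundedI[OF acts a]
    have "\<exists>i. R i j" for j
    proof -
      from lim obtain i where "j \<le> a i"
        unfolding filterlim_at_top eventually_at_top_linorder by blast
      then have "R i j" by (rule R_anti[OF R order_refl])
      then show ?thesis by blast
    qed
    with R show ?B by blast
  qed
  moreover have "A \<in> End_C n \<longleftrightarrow> (\<forall>i. \<exists>j. R i j) \<and> (\<forall>j. \<exists>i. R i j) \<and>
      (\<forall>i j. matrix_entry A i j \<in> End_C p)"
    using A by (simp only: n R_def End_C_Suc_iff simp_thms)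
  ultimately show ?thesis by (simp only: n diff_Suc_1 conj_assoc[symmetric])
qed

end
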